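(* Let $k\ge 1$ be an integer and let $\alpha\ge\beta\ge 0$. Let ${\bf P}_k^{(\alpha,\beta)}$ be the orthonormal Jacobi polynomial of degree $k$ and put $$ \delta_{\pm 1}=\frac{\beta^2-\alpha^2 \pm \sqrt{(2k+1)(2k+2\alpha+1)(2k+2\beta+1)(2k+2\alpha+2\beta+1)}}{(2k+\alpha+\beta+1)^2}, $$ $$ Z_k^{\alpha,\beta}(x)=\sqrt{\sqrt{(x-\delta_{-1})(\delta_1-x)}\,(1-x)^{\alpha}(1+x)^{\beta}}\;{\bf P}_k^{(\alpha,\beta)}(x),\qquad x\in[\delta_{-1},\delta_1]. $$ Then $$ \max_{x\in[\delta_{-1},\delta_1]}|Z_k^{\alpha,\beta}(x)|<5^{-1/4}\sqrt{3}. $$ Equivalently, $\max_{x\in[\delta_{-1},\delta_1]}\sqrt{(x-\delta_{-1})(\delta_1-x)}\,(1-x)^{\alpha}(1+x)^{\beta}\big({\bf P}_k^{(\alpha,\beta)}(x)\big)^2<\frac{3\sqrt5}{5}$.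
   Context: $P_k^{(\alpha,\beta)}$ denotes the Jacobi polynomial of degree $k$ in the standard (Szegő) normalization, orthogonal on $[-1,1]$ with respect to the weight $(1-x)^\alpha(1+x)^\beta$; its squared norm is ${\bf h}_k^2=\frac{2^{\alpha+\beta+1}\Gamma(k+\alpha+1)\Gamma(k+\beta+1)}{(2k+\alpha+\beta+1)\,k!\,\Gamma(k+\alpha+\beta+1)}$. The orthonormal Jacobi polynomial is ${\bf P}_k^{(\alpha,\beta)}=P_k^{(\alpha,\beta)}/{\bf h}_k$. One has $-1\le\delta_{-1}<\delta_1\le 1$. *)

theory Defs
  imports "HOL-Analysis.Analysis"
begin

text \<open>Jacobi polynomial in Szego normalization (explicit sum formula, valid for real
  parameters):  P_k(x) = sum_s binom(k+a, k-s) binom(k+b, s) ((x-1)/2)^s ((x+1)/2)^(k-s).\<close>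
definition jacobiP :: "nat \<Rightarrow> real \<Rightarrow> real \<Rightarrow> real \<Rightarrow> real" where
  "jacobiP k a b x =
     (\<Sum>s\<le>k. ((real k + a) gchoose (k - s)) * ((real k + b) gchoose s)
              * ((x - 1) / 2) ^ s * ((x + 1) / 2) ^ (k - s))"

definition jacobi_hsq :: "nat \<Rightarrow> real \<Rightarrow> real \<Rightarrow> real" where
  "jacobi_hsq k a b =
     2 powr (a + b + 1) * Gamma (real k + a + 1) * Gamma (real k + b + 1)
     / ((2 * real k + a + b + 1) * fact k * Gamma (real k + a + b + 1))"

definition jacobiP_on :: "nat \<Rightarrow> real \<Rightarrow> real \<Rightarrow> real \<Rightarrow> real" where
  "jacobiP_on k a b x = jacobiP k a b x / sqrt (jacobi_hsq k a b)"

text \<open>Real power with the convention t^0 = 1 (also at t = 0).\<close>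
definition rpow :: "real \<Rightarrow> real \<Rightarrow> real" where
  "rpow t e = (if e = 0 then 1 else t powr e)"

definition delta_pm :: "real \<Rightarrow> nat \<Rightarrow> real \<Rightarrow> real \<Rightarrow> real" where
  "delta_pm \<epsilon> k a b =
     (b^2 - a^2 + \<epsilon> * sqrt ((2*real k+1) * (2*real k+2*a+1) * (2*real k+2*b+1)
                               * (2*real k+2*a+2*b+1)))
     / (2*real k + a + b + 1)^2"

definition Zk :: "nat \<Rightarrow> real \<Rightarrow> real \<Rightarrow> real \<Rightarrow> real" where
  "Zk k a b x =
     sqrt (sqrt ((x - delta_pm (-1) k a b) * (delta_pm 1 k a b - x))
           * rpow (1 - x) a * rpow (1 + x) b) * jacobiP_on k a b x"

end

theory Submission
  imports Defs
begin

text \<open>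
  Put \<open>s = 1 - x\<^sup>2\<close>, \<open>r = 2 k + a + b + 1\<close>, \<open>R = r\<^sup>2 / 4\<close> and let \<open>m \<plusminus> W\<close> be the two points \<open>\<delta>\<close>. The function
  \<open>v = (1 - x) powr (a/2) * (1 + x) powr (b/2) * P\<close> satisfies \<open>s (s v')' + q v = 0\<close> with
  \<open>q = R (x - \<delta>\<^sub>-) (\<delta>\<^sub>+ - x) - s / 4\<close>; write \<open>u = s v'\<close>. By symmetry only \<open>x \<ge> m\<close> matters.

  The energy \<open>u\<^sup>2 + q v\<^sup>2\<close> vanishes at both ends of \<open>[-1, 1]\<close> and has derivative \<open>q' v\<^sup>2\<close> with \<open>q'\<close> linear.
  Hence its value at \<open>m\<close> is controlled by the mean deviation of the measure \<open>v\<^sup>2 dx\<close>, and thus by the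
  variance, which a second identity of the same kind computes exactly. This gives
  \<open>u\<^sup>2 + q v\<^sup>2 \<le> (3/4) R W \<parallel>v\<parallel>\<^sup>2\<close> at \<open>m\<close>.

  To the right of \<open>m\<close>, a Sonin function that dominates \<open>sqrt (\<delta>\<^sub>+ - x) v\<^sup>2\<close> decreases up to the turning
  point \<open>\<delta>\<^sub>+\<close>, and at \<open>m\<close> it is at most \<open>(63/50) sqrt W / (R W\<^sup>2)\<close> times the energy. With
  \<open>x - \<delta>\<^sub>- \<le> 2 W\<close> this bounds the squared expression by \<open>(189/200) sqrt 2 < 3 / sqrt 5\<close>.
\<close>

section \<open>Jacobi polynomials\<close>

lemma rpow_nonneg [simp]: "t \<ge> 0 \<Longrightarrow> rpow t e \<ge> 0"
  by (simp add: rpow_def)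

lemma rpow_0_left [simp]: "rpow 0 e = (if e = 0 then 1 else 0)"
  by (simp add: rpow_def)

lemma rpow_half_square: "t \<ge> 0 \<Longrightarrow> (rpow t (e / 2))\<^sup>2 = rpow t e"
  by (auto simp: rpow_def power2_eq_square simp flip: powr_add)

text \<open>The bound on \<open>e\<close> matters at \<open>t = 0\<close>: it keeps
  \<open>e + 1\<close> away from zero, so both sides vanish there.\<close>

lemma rpow_add_one: "t \<ge> 0 \<Longrightarrow> e \<ge> 0 \<Longrightarrow> rpow t (e + 1) = t * rpow t e"
  by (auto simp: rpow_def powr_add)

lemma has_real_derivative_rpow:
  assumes "t > 0"
  shows "((\<lambda>t. rpow t e) has_real_derivative e * rpow t e / t) (at t)"
proof (cases "e = 0")
  case False
  have "((\<lambda>t. t powr e) has_real_derivative e * t powr (e - 1)) (at t)"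
    by (rule has_real_derivative_powr[OF assms])
  moreover have "e * t powr (e - 1) = e * rpow t e / t"
    using assms False by (simp add: rpow_def powr_diff)
  ultimately show ?thesis
    using False by (simp add: rpow_def)
qed (simp add: rpow_def)

lemma continuous_on_rpow [continuous_intros]:
  assumes "continuous_on A f" "\<And>x. x \<in> A \<Longrightarrow> f x \<ge> 0" "e \<ge> 0"
  shows "continuous_on A (\<lambda>x. rpow (f x) e)"
proof (cases "e = 0")
  case False
  then have "e > 0" using assms(3) by simp
  then have "continuous_on A (\<lambda>x. f x powr e)"
    using assms by (intro continuous_on_powr') auto
  with False show ?thesis by (simp add: rpow_def)
qed (simp add: rpow_def)

section \<open>Lowering, raising and reflection formulas\<close>

lemma gbinomial_Suc_mult:
  "(1 + real s) * (c gchoose Suc s) = (c - real s) * (c gchoose s)"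
  using gbinomial_mult_1[of c s] by (simp add: algebra_simps)

lemma jacobiP_0 [simp]: "jacobiP 0 a b x = 1"
  by (simp add: jacobiP_def)

lemma continuous_on_jacobiP [continuous_intros]: "continuous_on A (jacobiP k a b)"
  unfolding jacobiP_def by (intro continuous_intros) auto

text \<open>Kept as a raw sum because both the lowering and the raising formula start from it. The
  truncated exponents \<open>s - 1\<close> and \<open>k - s - 1\<close> are harmless: where
  truncation occurs, the factor in front is zero.\<close>

lemma jacobiP_has_derivative_sum:
  "((jacobiP k a b) has_real_derivative
     (\<Sum>s\<le>k. ((real k + a) gchoose (k - s)) * ((real k + b) gchoose s)
        * (real s * ((x - 1) / 2) ^ (s - 1) * ((x + 1) / 2) ^ (k - s)
           + real (k - s) * ((x - 1) / 2) ^ s * ((x + 1) / 2) ^ (k - s - 1)) / 2)) (at x)"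
proof -
  have "((\<lambda>x. c * ((x - 1) / 2) ^ i * ((x + 1) / 2) ^ j) has_real_derivative
      c * (real i * ((x - 1) / 2) ^ (i - 1) * ((x + 1) / 2) ^ j
           + real j * ((x - 1) / 2) ^ i * ((x + 1) / 2) ^ (j - 1)) / 2) (at x)" for c :: real and i j
    by (rule derivative_eq_intros refl | simp)+ (simp add: add_divide_distrib algebra_simps)
  then show ?thesis
    unfolding jacobiP_def by (intro DERIV_sum)
qed

text \<open>Lowering formula. The upper binomial arguments agree on both sides, since
  \<open>Suc n + a = n + (a + 1)\<close>. The binomial recurrence turns the two halves of the
  product rule into factors \<open>B - s\<close> and \<open>A - (n - s)\<close>, whose sum does not
  depend on \<open>s\<close>.\<close>

lemma jacobiP_has_derivative:
  "(jacobiP (Suc n) a b has_real_derivative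
      (real n + a + b + 2) / 2 * jacobiP n (a + 1) (b + 1) x) (at x)"
proof -
  define X Y where "X = (x - 1) / 2" and "Y = (x + 1) / 2"
  define A B where "A = real n + (a + 1)" and "B = real n + (b + 1)"
  have A: "real (Suc n) + a = A" and B: "real (Suc n) + b = B"
    by (simp_all add: A_def B_def)
  let ?c = "\<lambda>s. (A gchoose (Suc n - s)) * (B gchoose s)"
  have "(\<Sum>s\<le>Suc n. ?c s * (real s * X ^ (s - 1) * Y ^ (Suc n - s)
           + real (Suc n - s) * X ^ s * Y ^ (Suc n - s - 1)) / 2)
      = (\<Sum>s\<le>Suc n. real s * ?c s * X ^ (s - 1) * Y ^ (Suc n - s)) / 2
        + (\<Sum>s\<le>Suc n. real (Suc n - s) * ?c s * X ^ s * Y ^ (Suc n - s - 1)) / 2"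
    by (simp only: sum_divide_distrib flip: sum.distrib) (auto intro!: sum.cong simp: field_simps)
  \<comment> \<open>The term \<open>s = 0\<close> vanishes, so the index can be shifted down; in the
    other half the last term vanishes instead.\<close>
  also have "(\<Sum>s\<le>Suc n. real s * ?c s * X ^ (s - 1) * Y ^ (Suc n - s))
      = (\<Sum>s\<le>n. (1 + real s) * ((A gchoose (n - s)) * (B gchoose Suc s)) * X ^ s * Y ^ (n - s))"
    by (subst sum.atMost_Suc_shift) simp
  also have "\<dots> = (\<Sum>s\<le>n. (B - real s) * (A gchoose (n - s)) * (B gchoose s) * X ^ s * Y ^ (n - s))"
  proof (intro sum.cong refl)
    fix s
    have "(1 + real s) * ((A gchoose (n - s)) * (B gchoose Suc s)) * X ^ s * Y ^ (n - s)
        = ((1 + real s) * (B gchoose Suc s)) * (A gchoose (n - s)) * X ^ s * Y ^ (n - s)"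
      by simp
    then show "(1 + real s) * ((A gchoose (n - s)) * (B gchoose Suc s)) * X ^ s * Y ^ (n - s)
        = (B - real s) * (A gchoose (n - s)) * (B gchoose s) * X ^ s * Y ^ (n - s)"
      unfolding gbinomial_Suc_mult by simp
  qed
  also have "(\<Sum>s\<le>Suc n. real (Suc n - s) * ?c s * X ^ s * Y ^ (Suc n - s - 1))
      = (\<Sum>s\<le>n. (A - real (n - s)) * (A gchoose (n - s)) * (B gchoose s) * X ^ s * Y ^ (n - s))"
  proof -
    have "real (Suc n - s) * ?c s * X ^ s * Y ^ (Suc n - s - 1)
        = (A - real (n - s)) * (A gchoose (n - s)) * (B gchoose s) * X ^ s * Y ^ (n - s)"
      if "s \<in> {..n}" for s
    proof -
      have e: "Suc n - s = Suc (n - s)" using that by simp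
      have "real (Suc n - s) * ?c s * X ^ s * Y ^ (Suc n - s - 1)
          = ((1 + real (n - s)) * (A gchoose Suc (n - s))) * (B gchoose s) * X ^ s * Y ^ (n - s)"
        unfolding e by simp
      then show ?thesis by (simp only: gbinomial_Suc_mult)
    qed
    then have "(\<Sum>s\<le>n. real (Suc n - s) * ?c s * X ^ s * Y ^ (Suc n - s - 1))
      = (\<Sum>s\<le>n. (A - real (n - s)) * (A gchoose (n - s)) * (B gchoose s) * X ^ s * Y ^ (n - s))"
      by (intro sum.cong refl)
    then show ?thesis
      unfolding sum.atMost_Suc by (simp only: diff_self_eq_0 of_nat_0 mult_zero_left add_0_right)
  qed
  also have "(\<Sum>s\<le>n. (B - real s) * (A gchoose (n - s)) * (B gchoose s) * X ^ s * Y ^ (n - s)) / 2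
      + (\<Sum>s\<le>n. (A - real (n - s)) * (A gchoose (n - s)) * (B gchoose s) * X ^ s * Y ^ (n - s)) / 2
      = (\<Sum>s\<le>n. (real n + a + b + 2) / 2 * ((A gchoose (n - s)) * (B gchoose s) * X ^ s * Y ^ (n - s)))"
    unfolding sum_divide_distrib sum.distrib[symmetric]
    by (intro sum.cong refl) (simp add: A_def B_def of_nat_diff field_simps)
  also have "\<dots> = (real n + a + b + 2) / 2 * jacobiP n (a + 1) (b + 1) x"
    by (simp add: jacobiP_def A_def B_def X_def Y_def sum_distrib_left)
  finally show ?thesis
    using jacobiP_has_derivative_sum[of "Suc n" a b x]
    by (simp only: A B X_def Y_def)
qed

text \<open>Raising formula, the adjoint of the lowering one: multiplied by the weight with
  exponents \<open>a\<close>, \<open>b\<close>, the left side is the derivative of the weight with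
  exponents \<open>a + 1\<close>, \<open>b + 1\<close> times the polynomial.\<close>

lemma jacobiP_raising:
  assumes "(jacobiP n (a + 1) (b + 1) has_real_derivative Q') (at x)"
  shows "(1 - x\<^sup>2) * Q' + ((b + 1) * (1 - x) - (a + 1) * (1 + x)) * jacobiP n (a + 1) (b + 1) x
         = - 2 * (real n + 1) * jacobiP (Suc n) a b x"
proof -
  define X Y where "X = (x - 1) / 2" and "Y = (x + 1) / 2"
  define A B where "A = real n + (a + 1)" and "B = real n + (b + 1)"
  have A: "real (Suc n) + a = A" and B: "real (Suc n) + b = B"
    by (simp_all add: A_def B_def)
  let ?c = "\<lambda>s. (A gchoose (n - s)) * (B gchoose s)"
  let ?d = "\<lambda>s. (A gchoose (Suc n - s)) * (B gchoose s) * X ^ s * Y ^ (Suc n - s)"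
  have Q': "Q' = (\<Sum>s\<le>n. ?c s * (real s * X ^ (s - 1) * Y ^ (n - s)
           + real (n - s) * X ^ s * Y ^ (n - s - 1)) / 2)"
    using DERIV_unique[OF assms jacobiP_has_derivative_sum] by (simp only: A_def B_def X_def Y_def)
  have Q: "jacobiP n (a + 1) (b + 1) x = (\<Sum>s\<le>n. ?c s * X ^ s * Y ^ (n - s))"
    by (simp only: jacobiP_def A_def B_def X_def Y_def)
  have "(1 - x\<^sup>2) * Q' + ((b + 1) * (1 - x) - (a + 1) * (1 + x)) * jacobiP n (a + 1) (b + 1) x
     = (\<Sum>s\<le>n. - 4 * X * Y * (?c s * (real s * X ^ (s - 1) * Y ^ (n - s)
           + real (n - s) * X ^ s * Y ^ (n - s - 1)) / 2)
         + (- 2 * (b + 1) * X - 2 * (a + 1) * Y) * (?c s * X ^ s * Y ^ (n - s)))"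
  proof -
    have "1 - x\<^sup>2 = - 4 * X * Y" "(b + 1) * (1 - x) - (a + 1) * (1 + x) = - 2 * (b + 1) * X - 2 * (a + 1) * Y"
      by (simp_all add: X_def Y_def field_simps power2_eq_square)
    then show ?thesis
      unfolding Q Q' sum.distrib sum_distrib_left[symmetric] by (simp only:)
  qed
  \<comment> \<open>Each summand feeds the two neighbouring terms \<open>?d s\<close> and
    \<open>?d (Suc s)\<close>. After an index shift, \<open>?d s\<close> collects
    \<open>(n + 1 - s) + s = n + 1\<close>.\<close>
  also have "\<dots> = (\<Sum>s\<le>n. - 2 * (real (Suc n - s) * ?d s + real (Suc s) * ?d (Suc s)))"
  proof (intro sum.cong refl)
    fix s assume "s \<in> {..n}"
    then have s: "s \<le> n" by simp
    have e: "Suc n - s = Suc (n - s)" using s by simp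
    have 1: "real s * X ^ (s - 1) * X = real s * X ^ s"
      by (cases s) auto
    have 2: "real (n - s) * Y ^ (n - s - 1) * Y = real (n - s) * Y ^ (n - s)"
      by (cases "n - s") auto
    have 3: "(1 + real (n - s)) * (A gchoose Suc (n - s)) = (a + 1 + real s) * (A gchoose (n - s))"
      using s by (simp only: gbinomial_Suc_mult) (simp add: A_def of_nat_diff)
    have 4: "(1 + real s) * (B gchoose Suc s) = (b + 1 + real (n - s)) * (B gchoose s)"
      using s by (simp only: gbinomial_Suc_mult) (simp add: B_def of_nat_diff)
    have "- 4 * X * Y * (?c s * (real s * X ^ (s - 1) * Y ^ (n - s)
           + real (n - s) * X ^ s * Y ^ (n - s - 1)) / 2)
         + (- 2 * (b + 1) * X - 2 * (a + 1) * Y) * (?c s * X ^ s * Y ^ (n - s))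
       = - 2 * ?c s * ((real s * X ^ (s - 1) * X) * Y * Y ^ (n - s)
            + (real (n - s) * Y ^ (n - s - 1) * Y) * X * X ^ s)
         + (- 2 * (b + 1) * X - 2 * (a + 1) * Y) * (?c s * X ^ s * Y ^ (n - s))"
      by (simp add: field_simps)
    also have "\<dots> = - 2 * (((a + 1 + real s) * (A gchoose (n - s))) * (B gchoose s) * X ^ s * (Y * Y ^ (n - s))
          + (A gchoose (n - s)) * ((b + 1 + real (n - s)) * (B gchoose s)) * (X * X ^ s) * Y ^ (n - s))"
      unfolding 1 2 by (simp add: algebra_simps)
    also have "\<dots> = - 2 * (real (Suc n - s) * ?d s + real (Suc s) * ?d (Suc s))"
      unfolding 3[symmetric] 4[symmetric] e by (simp add: algebra_simps)
    finally show "- 4 * X * Y * (?c s * (real s * X ^ (s - 1) * Y ^ (n - s)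
           + real (n - s) * X ^ s * Y ^ (n - s - 1)) / 2)
         + (- 2 * (b + 1) * X - 2 * (a + 1) * Y) * (?c s * X ^ s * Y ^ (n - s))
         = - 2 * (real (Suc n - s) * ?d s + real (Suc s) * ?d (Suc s))" .
  qed
  also have "\<dots> = - 2 * ((\<Sum>s\<le>n. real (Suc n - s) * ?d s) + (\<Sum>s\<le>n. real (Suc s) * ?d (Suc s)))"
    by (simp only: sum.distrib sum_distrib_left[symmetric])
  also have "(\<Sum>s\<le>n. real (Suc n - s) * ?d s) = (\<Sum>s\<le>Suc n. real (Suc n - s) * ?d s)"
    by simp
  also have "(\<Sum>s\<le>n. real (Suc s) * ?d (Suc s)) = (\<Sum>s\<le>Suc n. real s * ?d s)"
    by (simp only: sum.atMost_Suc_shift of_nat_0 mult_zero_left add_0_left)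
  also have "(\<Sum>s\<le>Suc n. real (Suc n - s) * ?d s) + (\<Sum>s\<le>Suc n. real s * ?d s)
      = (\<Sum>s\<le>Suc n. (real n + 1) * ?d s)"
    unfolding sum.distrib[symmetric]
  proof (intro sum.cong refl)
    fix s assume "s \<in> {..Suc n}"
    then have "real (Suc n - s) = real n + 1 - real s" by (simp add: of_nat_diff)
    then show "real (Suc n - s) * ?d s + real s * ?d s = (real n + 1) * ?d s"
      by (simp add: algebra_simps)
  qed
  also have "\<dots> = (real n + 1) * jacobiP (Suc n) a b x"
    unfolding jacobiP_def A B sum_distrib_left[symmetric] by (simp only: X_def Y_def)
  finally show ?thesis by (simp only: mult.assoc)
qed

text \<open>Reversing the order of summation exchanges the two parameters. This later reduces the
  left half of the interval to the right half.\<close>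

lemma jacobiP_minus: "jacobiP k a b (- x) = (- 1) ^ k * jacobiP k b a x"
proof -
  have "jacobiP k a b (- x) = (\<Sum>s\<le>k. ((real k + a) gchoose s) * ((real k + b) gchoose (k - s))
              * ((- x - 1) / 2) ^ (k - s) * ((- x + 1) / 2) ^ s)"
    unfolding jacobiP_def
    by (rule sum.reindex_bij_witness[of _ "\<lambda>s. k - s" "\<lambda>s. k - s"]) auto
  also have "\<dots> = (\<Sum>s\<le>k. (- 1) ^ k * (((real k + b) gchoose (k - s)) * ((real k + a) gchoose s)
              * ((x - 1) / 2) ^ s * ((x + 1) / 2) ^ (k - s)))"
  proof (intro sum.cong refl)
    fix s assume "s \<in> {..k}"
    then have k: "(- 1 :: real) ^ k = (- 1) ^ (k - s) * (- 1) ^ s"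
      by (simp flip: power_add)
    have 1: "((- x - 1) / 2) ^ (k - s) = (- 1) ^ (k - s) * ((x + 1) / 2) ^ (k - s)"
      unfolding power_mult_distrib[symmetric] by (rule arg_cong[where f = "\<lambda>y. y ^ (k - s)"]) simp
    have 2: "((- x + 1) / 2) ^ s = (- 1) ^ s * ((x - 1) / 2) ^ s"
      unfolding power_mult_distrib[symmetric] by (rule arg_cong[where f = "\<lambda>y. y ^ s"]) simp
    show "((real k + a) gchoose s) * ((real k + b) gchoose (k - s))
              * ((- x - 1) / 2) ^ (k - s) * ((- x + 1) / 2) ^ s
        = (- 1) ^ k * (((real k + b) gchoose (k - s)) * ((real k + a) gchoose s)
              * ((x - 1) / 2) ^ s * ((x + 1) / 2) ^ (k - s))"
      unfolding 1 2 k by (simp only: mult_ac)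
  qed
  finally show ?thesis
    by (simp add: jacobiP_def sum_distrib_left)
qed

section \<open>The weight and the norm of the Jacobi polynomials\<close>

definition jacobi_weight :: "real \<Rightarrow> real \<Rightarrow> real \<Rightarrow> real" where
  "jacobi_weight a b x = rpow (1 - x) a * rpow (1 + x) b"

lemma continuous_on_jacobi_weight:
  "a \<ge> 0 \<Longrightarrow> b \<ge> 0 \<Longrightarrow> continuous_on {-1..1} (jacobi_weight a b)"
  unfolding jacobi_weight_def by (intro continuous_intros) auto

lemma jacobi_weight_half_square:
  "x \<in> {-1..1} \<Longrightarrow> (jacobi_weight (a / 2) (b / 2) x)\<^sup>2 = jacobi_weight a b x"
  by (simp add: jacobi_weight_def power_mult_distrib rpow_half_square)

lemma jacobi_weight_add_one:
  assumes "x \<in> {-1..1}" "a \<ge> 0" "b \<ge> 0"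
  shows "jacobi_weight (a + 1) (b + 1) x = (1 - x\<^sup>2) * jacobi_weight a b x"
proof -
  have "1 - x\<^sup>2 = (1 - x) * (1 + x)"
    by (simp add: power2_eq_square algebra_simps)
  then show ?thesis
    using assms by (simp add: jacobi_weight_def rpow_add_one)
qed

lemma one_minus_square_pos: "x \<in> {-1<..<1} \<Longrightarrow> 1 - x\<^sup>2 > (0::real)"
  by (simp add: abs_square_less_1 abs_less_iff)

lemma jacobi_weight_has_derivative:
  assumes "x \<in> {-1<..<1}"
  shows "(jacobi_weight a b has_real_derivative
           (b * (1 - x) - a * (1 + x)) / (1 - x\<^sup>2) * jacobi_weight a b x) (at x)"
proof -
  have x: "1 - x > 0" "1 + x > 0" using assms by auto
  have 1: "((\<lambda>x. rpow (1 - x) a) has_real_derivative a * rpow (1 - x) a / (1 - x) * (0 - 1)) (at x)"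
    by (rule DERIV_chain2[where f = "\<lambda>t. rpow t a" and g = "\<lambda>x. 1 - x", OF has_real_derivative_rpow[OF x(1)]]) (auto intro!: derivative_eq_intros)
  have 2: "((\<lambda>x. rpow (1 + x) b) has_real_derivative b * rpow (1 + x) b / (1 + x) * (0 + 1)) (at x)"
    by (rule DERIV_chain2[where f = "\<lambda>t. rpow t b" and g = "\<lambda>x. 1 + x", OF has_real_derivative_rpow[OF x(2)]]) (auto intro!: derivative_eq_intros)
  have s: "1 - x\<^sup>2 = (1 - x) * (1 + x)"
    by (simp add: power2_eq_square algebra_simps)
  show ?thesis
    unfolding jacobi_weight_def s
    by (rule DERIV_cong[OF DERIV_mult[OF 1 2]]) (use x in \<open>simp add: field_simps\<close>)
qed

text \<open>Euler's Beta integral under the substitution \<open>x = 2 t - 1\<close>.\<close>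

lemma jacobi_weight_integral:
  assumes "a \<ge> 0" "b \<ge> 0"
  shows "(jacobi_weight a b has_integral 2 powr (a + b + 1) * Beta (a + 1) (b + 1)) {-1..1}"
proof -
  have "((\<lambda>t. t powr b * (1 - t) powr a) has_integral Beta (b + 1) (a + 1)) (cbox 0 (1::real))"
    using has_integral_Beta_real[of "b + 1" "a + 1"] assms by simp
  from has_integral_affinity'[OF this, of "1/2" "1/2"]
  have "((\<lambda>x. (x / 2 + 1 / 2) powr b * (1 - (x / 2 + 1 / 2)) powr a)
           has_integral 2 * Beta (b + 1) (a + 1)) {-1..1}"
    by simp
  from has_integral_mult_right[OF this, of "2 powr (a + b)"]
  have I: "((\<lambda>x. 2 powr (a + b) * ((x / 2 + 1 / 2) powr b * (1 - (x / 2 + 1 / 2)) powr a))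
           has_integral 2 powr (a + b + 1) * Beta (a + 1) (b + 1)) {-1..1}"
    by (simp add: powr_add Beta_commute mult_ac)
  \<comment> \<open>The endpoints are exempted because \<open>0 powr 0 = 0\<close>, whereas
    \<open>rpow 0 0 = 1\<close>.\<close>
  show ?thesis
  proof (rule has_integral_spike_finite[OF _ _ I, of "{-1, 1}"])
    fix x :: real assume "x \<in> {-1..1} - {-1, 1}"
    then have x: "1 - x > 0" "1 + x > 0" by auto
    have "(x / 2 + 1 / 2) powr b = (1 + x) powr b / 2 powr b"
      using x by (subst powr_divide[symmetric]) (auto simp: field_simps)
    moreover have "(1 - (x / 2 + 1 / 2)) powr a = (1 - x) powr a / 2 powr a"
      using x by (subst powr_divide[symmetric]) (auto simp: field_simps)
    ultimately show "jacobi_weight a b x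
        = 2 powr (a + b) * ((x / 2 + 1 / 2) powr b * (1 - (x / 2 + 1 / 2)) powr a)"
      using x by (simp add: jacobi_weight_def rpow_def powr_add)
  qed simp
qed

lemma jacobi_hsq_pos: "a \<ge> 0 \<Longrightarrow> b \<ge> 0 \<Longrightarrow> jacobi_hsq k a b > 0"
  unfolding jacobi_hsq_def by (intro divide_pos_pos mult_pos_pos Gamma_real_pos) auto

text \<open>This is the recurrence that integration by parts produces for the norms.\<close>

lemma jacobi_hsq_Suc:
  assumes "a \<ge> 0" "b \<ge> 0"
  shows "jacobi_hsq (Suc n) a b
       = (real n + a + b + 2) / (4 * (real n + 1)) * jacobi_hsq n (a + 1) (b + 1)"
proof -
  have "Gamma (real n + a + b + 2 + 1) = (real n + a + b + 2) * Gamma (real n + a + b + 2)"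
    using assms by (intro Gamma_plus1) (auto elim!: nonpos_Ints_cases)
  then have G: "Gamma (real n + (a + 1) + (b + 1) + 1) = (real n + a + b + 2) * Gamma (real (Suc n) + a + b + 1)"
    by (simp add: add_ac)
  have p: "2 powr (a + 1 + (b + 1) + 1) = 4 * 2 powr (a + b + 1)"
    using powr_add[of 2 2 "a + b + 1"] by (simp add: add_ac)
  have e: "real n + (a + 1) + 1 = real (Suc n) + a + 1" "real n + (b + 1) + 1 = real (Suc n) + b + 1"
      "2 * real n + (a + 1) + (b + 1) + 1 = 2 * real (Suc n) + a + b + 1"
    by simp_all
  have f: "fact (Suc n) = (real n + 1) * fact n"
    by simp
  have "p * g1 * g2 / (\<rho> * (N * \<phi>) * g3)
      = y / (4 * N) * (4 * p * g1 * g2 / (\<rho> * \<phi> * (y * g3)))"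
    if "y \<noteq> 0" for p g1 g2 g3 \<rho> \<phi> y N :: real
    using that by (simp add: mult_ac)
  moreover have "real n + a + b + 2 \<noteq> 0"
    using assms by linarith
  ultimately show ?thesis
    unfolding jacobi_hsq_def G p e f by blast
qed

text \<open>Integrating the derivative of \<open>?w1 * ?Q * ?P\<close> and using the lowering and
  raising formulas trades degree \<open>n + 1\<close> at \<open>(a, b)\<close> for degree
  \<open>n\<close> at \<open>(a + 1, b + 1)\<close>; hence the induction over all parameters. The
  boundary terms vanish because the exponents of \<open>?w1\<close> are positive.\<close>

lemma jacobiP_square_integral:
  assumes "a \<ge> 0" "b \<ge> 0"
  shows "((\<lambda>x. jacobi_weight a b x * (jacobiP k a b x)\<^sup>2) has_integral jacobi_hsq k a b) {-1..1}"
  using assms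
proof (induction k arbitrary: a b)
  case 0
  have "2 powr (a + b + 1) * Beta (a + 1) (b + 1) = jacobi_hsq 0 a b"
  proof -
    have "Gamma (a + b + 1 + 1) = (a + b + 1) * Gamma (a + b + 1)"
      using 0 by (intro Gamma_plus1) (auto elim!: nonpos_Ints_cases)
    then show ?thesis
      by (simp add: jacobi_hsq_def Beta_def add_ac)
  qed
  then show ?case
    using jacobi_weight_integral[OF 0] by simp
next
  case (Suc n)
  let ?w = "jacobi_weight a b" and ?w1 = "jacobi_weight (a + 1) (b + 1)"
  let ?P = "jacobiP (Suc n) a b" and ?Q = "jacobiP n (a + 1) (b + 1)"
  let ?c = "(real n + a + b + 2) / 2"
  have "((\<lambda>x. ?c * (?w1 x * (?Q x)\<^sup>2) - 2 * (real n + 1) * (?w x * (?P x)\<^sup>2))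
        has_integral ?w1 1 * ?Q 1 * ?P 1 - ?w1 (-1) * ?Q (-1) * ?P (-1)) {-1..1}"
  proof (rule fundamental_theorem_of_calculus_interior)
    show "continuous_on {-1..1} (\<lambda>x. ?w1 x * ?Q x * ?P x)"
      using Suc.prems by (intro continuous_intros continuous_on_jacobi_weight) auto
    fix x :: real assume x: "x \<in> {-1<..<1}"
    obtain Q' where Q': "(?Q has_real_derivative Q') (at x)"
      using jacobiP_has_derivative_sum by blast
    have w: "?w1 x = (1 - x\<^sup>2) * ?w x"
      using x Suc.prems by (intro jacobi_weight_add_one) auto
    have s: "1 - x\<^sup>2 \<noteq> 0"
      using one_minus_square_pos[OF x] by simp
    have "((\<lambda>x. ?w1 x * ?Q x) has_real_derivative - 2 * (real n + 1) * (?w x * ?P x)) (at x)"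
    proof (rule DERIV_cong[OF DERIV_mult[OF jacobi_weight_has_derivative[OF x] Q']])
      have "((b + 1) * (1 - x) - (a + 1) * (1 + x)) / (1 - x\<^sup>2) * ?w1 x * ?Q x + Q' * ?w1 x
          = ?w x * ((1 - x\<^sup>2) * Q' + ((b + 1) * (1 - x) - (a + 1) * (1 + x)) * ?Q x)"
      proof -
        have "L / \<sigma> * (\<sigma> * y) * z + z' * (\<sigma> * y) = y * (\<sigma> * z' + L * z)"
          if "\<sigma> \<noteq> 0" for L \<sigma> y z z' :: real
          using that by (simp add: field_simps)
        from this[OF s] show ?thesis unfolding w .
      qed
      also have "\<dots> = - 2 * (real n + 1) * (?w x * ?P x)"
        unfolding jacobiP_raising[OF Q'] by simp
      finally show "((b + 1) * (1 - x) - (a + 1) * (1 + x)) / (1 - x\<^sup>2) * ?w1 x * ?Q x + Q' * ?w1 x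
          = - 2 * (real n + 1) * (?w x * ?P x)" .
    qed
    from DERIV_mult[OF this jacobiP_has_derivative]
    show "((\<lambda>x. ?w1 x * ?Q x * ?P x) has_vector_derivative
        ?c * (?w1 x * (?Q x)\<^sup>2) - 2 * (real n + 1) * (?w x * (?P x)\<^sup>2)) (at x)"
      unfolding has_real_derivative_iff_has_vector_derivative[symmetric]
      by (rule DERIV_cong) (simp add: power2_eq_square algebra_simps)
  qed simp
  moreover have "?w1 1 = 0" "?w1 (-1) = 0"
    using Suc.prems by (auto simp: jacobi_weight_def)
  ultimately have I: "((\<lambda>x. ?c * (?w1 x * (?Q x)\<^sup>2) - 2 * (real n + 1) * (?w x * (?P x)\<^sup>2))
        has_integral 0) {-1..1}"
    by simp
  have J: "((\<lambda>x. ?c * (?w1 x * (?Q x)\<^sup>2)) has_integral ?c * jacobi_hsq n (a + 1) (b + 1)) {-1..1}"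
    using Suc.prems by (intro has_integral_mult_right Suc.IH) auto
  from has_integral_mult_right[OF has_integral_diff[OF J I], of "1 / (2 * (real n + 1))"]
  have "((\<lambda>x. ?w x * (?P x)\<^sup>2) has_integral
      1 / (2 * (real n + 1)) * (?c * jacobi_hsq n (a + 1) (b + 1))) {-1..1}"
    by simp
  then show ?case
    using Suc.prems by (simp add: jacobi_hsq_Suc)
qed

section \<open>The weighted polynomial and its differential equation\<close>

definition jacobi_fun :: "nat \<Rightarrow> real \<Rightarrow> real \<Rightarrow> real \<Rightarrow> real" where
  "jacobi_fun k a b x = jacobi_weight (a / 2) (b / 2) x * jacobiP k a b x"

text \<open>The function \<open>u = (1 - x\<^sup>2) v'\<close>, expanded by the lowering formula so
  that no division occurs and it stays continuous at both endpoints. The degree \<open>k - 1\<close>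
  is meant for \<open>k \<ge> 1\<close>.\<close>

definition jacobi_flux :: "nat \<Rightarrow> real \<Rightarrow> real \<Rightarrow> real \<Rightarrow> real" where
  "jacobi_flux k a b x = jacobi_weight (a / 2) (b / 2) x *
     ((1 - x\<^sup>2) * ((real k + a + b + 1) / 2 * jacobiP (k - 1) (a + 1) (b + 1) x)
      + (b * (1 - x) - a * (1 + x)) / 2 * jacobiP k a b x)"

lemma jacobi_fun_has_derivative:
  assumes "x \<in> {-1<..<1}" "k \<ge> 1"
  shows "(jacobi_fun k a b has_real_derivative jacobi_flux k a b x / (1 - x\<^sup>2)) (at x)"
proof -
  obtain n where k: "k = Suc n" using assms(2) by (cases k) auto
  have s: "1 - x\<^sup>2 \<noteq> 0" using one_minus_square_pos[OF assms(1)] by simp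
  show ?thesis
    unfolding jacobi_fun_def k
  proof (rule DERIV_cong[OF DERIV_mult[OF jacobi_weight_has_derivative[OF assms(1)] jacobiP_has_derivative]])
    have "(b / 2 * (1 - x) - a / 2 * (1 + x)) / \<sigma> * \<omega> * P + (real n + a + b + 2) / 2 * Q * \<omega>
        = \<omega> * (\<sigma> * ((real (Suc n) + a + b + 1) / 2 * Q) + (b * (1 - x) - a * (1 + x)) / 2 * P) / \<sigma>"
      if "\<sigma> \<noteq> 0" for \<sigma> \<omega> P Q :: real
      using that by (simp add: field_simps)
    from this[OF s] show "(b / 2 * (1 - x) - a / 2 * (1 + x)) / (1 - x\<^sup>2) * jacobi_weight (a / 2) (b / 2) x
          * jacobiP (Suc n) a b x
        + (real n + a + b + 2) / 2 * jacobiP n (a + 1) (b + 1) x * jacobi_weight (a / 2) (b / 2) x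
        = jacobi_flux (Suc n) a b x / (1 - x\<^sup>2)"
      unfolding jacobi_flux_def diff_Suc_1 .
  qed
qed

text \<open>The Jacobi equation in self-adjoint form. It is the lowering formula followed by the
  raising one, which removes the second derivative.\<close>

lemma jacobi_flux_has_derivative:
  fixes a b x :: real
  assumes "x \<in> {-1<..<1}" "k \<ge> 1"
  defines "r \<equiv> 2 * real k + a + b + 1"
  shows "(jacobi_flux k a b has_real_derivative
     - ((r\<^sup>2 - 1) / 4 * (1 - x\<^sup>2) - (a\<^sup>2 * (1 + x) + b\<^sup>2 * (1 - x)) / 2) * jacobi_fun k a b x / (1 - x\<^sup>2)) (at x)"
proof -
  obtain n where k: "k = Suc n" using assms(2) by (cases k) auto
  have s: "1 - x\<^sup>2 \<noteq> 0" using one_minus_square_pos[OF assms(1)] by simp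
  let ?\<omega> = "jacobi_weight (a / 2) (b / 2) x"
  let ?P = "jacobiP (Suc n) a b x" and ?Q = "jacobiP n (a + 1) (b + 1) x"
  define c where "c = (real n + a + b + 2) / 2"
  define l where "l = (b * (1 - x) - a * (1 + x)) / 2"
  obtain Q' where Q': "(jacobiP n (a + 1) (b + 1) has_real_derivative Q') (at x)"
    using jacobiP_has_derivative_sum by blast
  have sQ': "(1 - x\<^sup>2) * Q' = - 2 * (real n + 1) * ?P - (2 * l - 2 * x) * ?Q"
    using jacobiP_raising[OF Q'] by (simp add: l_def field_simps)
  have eq: "jacobi_flux k a b = (\<lambda>x. jacobi_weight (a / 2) (b / 2) x *
     ((1 - x\<^sup>2) * (c * jacobiP n (a + 1) (b + 1) x)
      + (b * (1 - x) - a * (1 + x)) / 2 * jacobiP (Suc n) a b x))"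
    by (simp add: fun_eq_iff jacobi_flux_def k c_def add_ac)
  have D1: "((\<lambda>x. jacobi_weight (a / 2) (b / 2) x) has_real_derivative l / (1 - x\<^sup>2) * ?\<omega>) (at x)"
    by (rule DERIV_cong[OF jacobi_weight_has_derivative[OF assms(1)]]) (simp add: l_def diff_divide_distrib)
  have D2: "((\<lambda>x. (1 - x\<^sup>2) * (c * jacobiP n (a + 1) (b + 1) x)) has_real_derivative
       c * ((1 - x\<^sup>2) * Q' - 2 * x * ?Q)) (at x)"
    by (rule derivative_eq_intros Q' refl | simp)+ (simp add: algebra_simps)
  have D3: "((\<lambda>x. (b * (1 - x) - a * (1 + x)) / 2 * jacobiP (Suc n) a b x) has_real_derivative
       - (a + b) / 2 * ?P + l * (c * ?Q)) (at x)"
    by (rule derivative_eq_intros jacobiP_has_derivative refl | simp)+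
       (simp add: l_def c_def field_simps)
  \<comment> \<open>Here \<open>2 * c * (n + 1)\<close> is the Jacobi eigenvalue
    \<open>k (k + a + b + 1)\<close>, and \<open>l\<close> is half the numerator of the weight's
    logarithmic derivative.\<close>
  have q: "(r\<^sup>2 - 1) / 4 * (1 - x\<^sup>2) - (a\<^sup>2 * (1 + x) + b\<^sup>2 * (1 - x)) / 2
      = (1 - x\<^sup>2) * (2 * c * (real n + 1) + (a + b) / 2) - l\<^sup>2"
    unfolding r_def k c_def l_def by (simp add: power2_eq_square field_simps)
  have "(jacobi_flux k a b has_real_derivative
     l / (1 - x\<^sup>2) * ?\<omega> * ((1 - x\<^sup>2) * (c * ?Q) + l * ?P)
      + ?\<omega> * (c * ((1 - x\<^sup>2) * Q' - 2 * x * ?Q) + (- (a + b) / 2 * ?P + l * (c * ?Q)))) (at x)"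
    unfolding eq
    by (rule DERIV_cong[OF DERIV_mult[OF D1 DERIV_add[OF D2 D3]]]) (simp add: l_def mult_ac)
  then show ?thesis
  proof (rule DERIV_cong)
    show "l / (1 - x\<^sup>2) * ?\<omega> * ((1 - x\<^sup>2) * (c * ?Q) + l * ?P)
      + ?\<omega> * (c * ((1 - x\<^sup>2) * Q' - 2 * x * ?Q) + (- (a + b) / 2 * ?P + l * (c * ?Q)))
      = - ((r\<^sup>2 - 1) / 4 * (1 - x\<^sup>2) - (a\<^sup>2 * (1 + x) + b\<^sup>2 * (1 - x)) / 2) * jacobi_fun k a b x / (1 - x\<^sup>2)"
    proof -
      have "l / \<sigma> * \<omega> * (\<sigma> * (c * Q) + l * P)
        + \<omega> * (c * (- 2 * (real n + 1) * P - (2 * l - 2 * x) * Q - 2 * x * Q) + (- (a + b) / 2 * P + l * (c * Q)))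
        = - (\<sigma> * (2 * c * (real n + 1) + (a + b) / 2) - l\<^sup>2) * (\<omega> * P) / \<sigma>"
        if "\<sigma> \<noteq> 0" for \<sigma> \<omega> P Q :: real
        using that by (simp add: field_simps power2_eq_square)
      from this[OF s] show ?thesis
        unfolding q sQ' jacobi_fun_def k .
    qed
  qed
qed

lemma jacobi_flux_endpoints:
  assumes "a \<ge> 0" "b \<ge> 0"
  shows "jacobi_flux k a b 1 = 0" "jacobi_flux k a b (-1) = 0"
  using assms by (auto simp: jacobi_flux_def jacobi_weight_def)

text \<open>Stated as products because \<open>v\<close> need not vanish at an endpoint whose
  exponent is zero.\<close>

lemma jacobi_fun_endpoints:
  assumes "a \<ge> 0" "b \<ge> 0"
  shows "a * jacobi_fun k a b 1 = 0" "b * jacobi_fun k a b (-1) = 0"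
  using assms by (auto simp: jacobi_fun_def jacobi_weight_def)

lemma continuous_on_jacobi_fun:
  assumes "a \<ge> 0" "b \<ge> 0"
  shows "continuous_on {-1..1} (jacobi_fun k a b)" "continuous_on {-1..1} (jacobi_flux k a b)"
  unfolding jacobi_fun_def jacobi_flux_def using assms
  by (intro continuous_intros continuous_on_jacobi_weight; simp)+

lemma jacobi_fun_square:
  "x \<in> {-1..1} \<Longrightarrow> (jacobi_fun k a b x)\<^sup>2 = jacobi_weight a b x * (jacobiP k a b x)\<^sup>2"
  by (simp add: jacobi_fun_def power_mult_distrib jacobi_weight_half_square)

lemma jacobi_fun_square_integral:
  assumes "a \<ge> 0" "b \<ge> 0"
  shows "((\<lambda>x. (jacobi_fun k a b x)\<^sup>2) has_integral jacobi_hsq k a b) {-1..1}"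
  using jacobiP_square_integral[OF assms]
  by (rule has_integral_eq[rotated]) (simp add: jacobi_fun_square)

section \<open>Energy at the centre\<close>

text \<open>Isolates what the estimate needs from the Jacobi case. \<open>v_ends\<close> says that
  \<open>q v\<close> vanishes at both endpoints. \<open>variance\<close> bounds the second moment;
  \<open>RW4\<close> makes the error terms at the centre small.\<close>

locale sonin_system =
  fixes v u :: "real \<Rightarrow> real" and R m W H :: real
  assumes cont: "continuous_on {-1..1} v" "continuous_on {-1..1} u"
    and v_deriv: "\<And>x. x \<in> {-1<..<1} \<Longrightarrow> (v has_real_derivative u x / (1 - x\<^sup>2)) (at x)"
    and u_deriv: "\<And>x. x \<in> {-1<..<1} \<Longrightarrow> (u has_real_derivative
        - (R * (W\<^sup>2 - (x - m)\<^sup>2) - (1 - x\<^sup>2) / 4) * v x / (1 - x\<^sup>2)) (at x)"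
    and u_ends: "u 1 = 0" "u (-1) = 0"
    and v_ends: "(W\<^sup>2 - (1 - m)\<^sup>2) * v 1 = 0" "(W\<^sup>2 - (-1 - m)\<^sup>2) * v (-1) = 0"
    and mass: "((\<lambda>x. (v x)\<^sup>2) has_integral H) {-1..1}"
    and W_pos: "W > 0" and mW: "\<bar>m\<bar> + W \<le> 1" and R_ge: "R \<ge> 9 / 4"
    and RW4: "R * W ^ 4 \<ge> 9 / 4 * (1 - m\<^sup>2)\<^sup>2"
    and variance: "(2 * R * W\<^sup>2 - 3 / 2) * (R - 1 / 4)\<^sup>2 + (7 / 2 * R\<^sup>2 - R / 8) * m\<^sup>2
        \<le> 9 / 4 * (R - 1) * R\<^sup>2 * W\<^sup>2"
begin

definition q :: "real \<Rightarrow> real" where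
  "q x = R * (W\<^sup>2 - (x - m)\<^sup>2) - (1 - x\<^sup>2) / 4"

lemma u_deriv_q: "x \<in> {-1<..<1} \<Longrightarrow> (u has_real_derivative - q x * v x / (1 - x\<^sup>2)) (at x)"
  unfolding q_def by (rule u_deriv)

lemma q_deriv: "(q has_real_derivative x / 2 - 2 * R * (x - m)) (at x)"
  unfolding q_def by (auto intro!: derivative_eq_intros simp: field_simps)

lemma q_ends: "q 1 * v 1 = 0" "q (-1) * v (-1) = 0"
  using v_ends by (auto simp: q_def)

lemma cont_q: "continuous_on A q"
  unfolding q_def by (intro continuous_intros) auto

lemma m_bounds: "-1 < m" "m < 1" "m + W \<le> 1" "-1 \<le> m - W"
  using W_pos mW by auto

definition energy :: "real \<Rightarrow> real" where
  "energy x = (u x)\<^sup>2 + q x * (v x)\<^sup>2"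

lemma energy_ends: "energy 1 = 0" "energy (-1) = 0"
  using q_ends u_ends by (auto simp: energy_def)

lemma cont_energy: "continuous_on {-1..1} energy"
  unfolding energy_def by (intro continuous_intros cont cont_q)

text \<open>The terms in \<open>u v\<close> cancel by the differential equation; only
  \<open>q'\<close> survives.\<close>

lemma energy_deriv:
  assumes "x \<in> {-1<..<1}"
  shows "(energy has_real_derivative (x / 2 - 2 * R * (x - m)) * (v x)\<^sup>2) (at x)"
  unfolding energy_def
  by (rule derivative_eq_intros v_deriv[OF assms] u_deriv_q[OF assms] q_deriv refl)+ simp

lemma energy_integral:
  assumes "-1 \<le> c" "c \<le> d" "d \<le> 1"
  shows "((\<lambda>x. (x / 2 - 2 * R * (x - m)) * (v x)\<^sup>2) has_integral energy d - energy c) {c..d}"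
proof (rule fundamental_theorem_of_calculus_interior)
  show "continuous_on {c..d} energy"
    using assms by (intro continuous_on_subset[OF cont_energy]) auto
  fix x assume "x \<in> {c<..<d}"
  with assms show "(energy has_vector_derivative (x / 2 - 2 * R * (x - m)) * (v x)\<^sup>2) (at x)"
    unfolding has_real_derivative_iff_has_vector_derivative[symmetric] by (intro energy_deriv) auto
qed fact

text \<open>The quadratic form attached to the multiplier \<open>g\<close> is
  \<open>g u\<^sup>2 - g' u v + (g'' / 2 + q g) v\<^sup>2\<close>, primes denoting \<open>(1 - x\<^sup>2) d/dx\<close>. The energy is the case
  \<open>g = 1\<close>; the case \<open>g = x\<close> yields the second moment.\<close>
lemma second_virial:
  "((\<lambda>x. (4 * (1 - R) * x\<^sup>2 + 6 * R * m * x + (2 * R * (W\<^sup>2 - m\<^sup>2) - 3 / 2)) * (v x)\<^sup>2)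
     has_integral 0) {-1..1}"
proof -
  define G where "G x = x * (u x)\<^sup>2 - (1 - x\<^sup>2) * u x * v x + (q x * x - x * (1 - x\<^sup>2)) * (v x)\<^sup>2" for x
  have "((\<lambda>x. (4 * (1 - R) * x\<^sup>2 + 6 * R * m * x + (2 * R * (W\<^sup>2 - m\<^sup>2) - 3 / 2)) * (v x)\<^sup>2)
     has_integral G 1 - G (-1)) {-1..1}"
  proof (rule fundamental_theorem_of_calculus_interior)
    show "continuous_on {-1..1} G"
      unfolding G_def by (intro continuous_intros cont cont_q)
    fix x :: real assume x: "x \<in> {-1<..<1}"
    have s: "1 - x\<^sup>2 \<noteq> 0" using one_minus_square_pos[OF x] by simp
    have "(G has_real_derivative
        (u x)\<^sup>2 + x * (2 * u x * (- q x * v x / (1 - x\<^sup>2)))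
        - (- 2 * x * u x * v x + (1 - x\<^sup>2) * (- q x * v x / (1 - x\<^sup>2)) * v x + (1 - x\<^sup>2) * u x * (u x / (1 - x\<^sup>2)))
        + ((x / 2 - 2 * R * (x - m)) * x + q x - (1 - x\<^sup>2) + 2 * x\<^sup>2) * (v x)\<^sup>2
        + (q x * x - x * (1 - x\<^sup>2)) * (2 * v x * (u x / (1 - x\<^sup>2)))) (at x)"
      unfolding G_def
      by (rule derivative_eq_intros v_deriv[OF x] u_deriv_q[OF x] q_deriv refl)+
         (simp add: algebra_simps power2_eq_square)
    \<comment> \<open>All terms in \<open>u\<^sup>2\<close> and \<open>u v\<close> cancel.\<close>
    moreover have "(u x)\<^sup>2 + x * (2 * u x * (- q x * v x / (1 - x\<^sup>2)))
        - (- 2 * x * u x * v x + (1 - x\<^sup>2) * (- q x * v x / (1 - x\<^sup>2)) * v x + (1 - x\<^sup>2) * u x * (u x / (1 - x\<^sup>2)))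
        + ((x / 2 - 2 * R * (x - m)) * x + q x - (1 - x\<^sup>2) + 2 * x\<^sup>2) * (v x)\<^sup>2
        + (q x * x - x * (1 - x\<^sup>2)) * (2 * v x * (u x / (1 - x\<^sup>2)))
        = ((x / 2 - 2 * R * (x - m)) * x + 2 * q x - (1 - x\<^sup>2) + 2 * x\<^sup>2) * (v x)\<^sup>2"
    proof -
      have "y\<^sup>2 + x * (2 * y * (- p * z / \<sigma>))
        - (- 2 * x * y * z + \<sigma> * (- p * z / \<sigma>) * z + \<sigma> * y * (y / \<sigma>))
        + (k + p - \<sigma> + 2 * x\<^sup>2) * z\<^sup>2 + (p * x - x * \<sigma>) * (2 * z * (y / \<sigma>))
        = (k + 2 * p - \<sigma> + 2 * x\<^sup>2) * z\<^sup>2" if "\<sigma> \<noteq> 0" for y z p \<sigma> k :: real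
        using that by (simp add: field_simps power2_eq_square)
      from this[OF s] show ?thesis .
    qed
    moreover have "(x / 2 - 2 * R * (x - m)) * x + 2 * q x - (1 - x\<^sup>2) + 2 * x\<^sup>2
        = 4 * (1 - R) * x\<^sup>2 + 6 * R * m * x + (2 * R * (W\<^sup>2 - m\<^sup>2) - 3 / 2)"
      by (simp add: q_def field_simps power2_eq_square)
    ultimately show "(G has_vector_derivative
        (4 * (1 - R) * x\<^sup>2 + 6 * R * m * x + (2 * R * (W\<^sup>2 - m\<^sup>2) - 3 / 2)) * (v x)\<^sup>2) (at x)"
      unfolding has_real_derivative_iff_has_vector_derivative[symmetric] by simp
  qed simp
  moreover have "G 1 = 0" "G (-1) = 0"
    using q_ends u_ends by (auto simp: G_def)
  ultimately show ?thesis by simp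
qed

lemma mass_nonneg: "H \<ge> 0"
  by (rule has_integral_nonneg[OF mass]) simp

text \<open>The linear factor is \<open>- q'\<close>, whose mean against \<open>v\<^sup>2\<close> is
  zero by the energy identity, so the integral is a scaled variance. Two virial identities determine
  the first and second moments exactly.\<close>

lemma variance_integral:
  "\<exists>V. ((\<lambda>x. (2 * (R - 1 / 4) * x - 2 * R * m)\<^sup>2 * (v x)\<^sup>2) has_integral V) {-1..1}
     \<and> V \<le> (3 / 2 * R * W)\<^sup>2 * H"
proof -
  have "(\<lambda>x. x * (v x)\<^sup>2) integrable_on {-1..1}" "(\<lambda>x. x\<^sup>2 * (v x)\<^sup>2) integrable_on {-1..1}"
    by (intro integrable_continuous_real continuous_intros cont)+
  then obtain I J where I: "((\<lambda>x. x * (v x)\<^sup>2) has_integral I) {-1..1}"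
    and J: "((\<lambda>x. x\<^sup>2 * (v x)\<^sup>2) has_integral J) {-1..1}"
    unfolding integrable_on_def by blast
  have lin: "((\<lambda>x. (\<alpha> * x\<^sup>2 + \<beta> * x + \<gamma>) * (v x)\<^sup>2) has_integral \<alpha> * J + \<beta> * I + \<gamma> * H) {-1..1}"
    for \<alpha> \<beta> \<gamma>
    using has_integral_add[OF has_integral_add[OF has_integral_mult_right[OF J, of \<alpha>]
          has_integral_mult_right[OF I, of \<beta>]] has_integral_mult_right[OF mass, of \<gamma>]]
    by (simp add: algebra_simps)
  have "((\<lambda>x. (0 * x\<^sup>2 + (1 / 2 - 2 * R) * x + 2 * R * m) * (v x)\<^sup>2) has_integral 0) {-1..1}"
    using energy_integral[of "-1" 1] by (simp add: energy_ends algebra_simps)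
  from has_integral_unique[OF lin this]
  have 1: "(R - 1 / 4) * I = R * m * H"
    by (simp add: algebra_simps)
  from has_integral_unique[OF lin second_virial]
  have 2: "4 * (R - 1) * J = 6 * R * m * I + (2 * R * (W\<^sup>2 - m\<^sup>2) - 3 / 2) * H"
    by (simp add: algebra_simps)
  define V where "V = 4 * (R - 1 / 4)\<^sup>2 * J + (- 8 * (R - 1 / 4) * R * m) * I + (4 * R\<^sup>2 * m\<^sup>2) * H"
  have V: "((\<lambda>x. (2 * (R - 1 / 4) * x - 2 * R * m)\<^sup>2 * (v x)\<^sup>2) has_integral V) {-1..1}"
    using lin[of "4 * (R - 1 / 4)\<^sup>2" "- 8 * (R - 1 / 4) * R * m" "4 * R\<^sup>2 * m\<^sup>2"]
    unfolding V_def by (rule has_integral_eq[rotated]) (simp add: power2_eq_square algebra_simps)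
  \<comment> \<open>The second moment is known only with the factor \<open>4 * (R - 1)\<close>, so
    everything is scaled by \<open>R - 1\<close>, positive by \<open>R_ge\<close>.\<close>
  have "(R - 1) * V = (R - 1 / 4)\<^sup>2 * (4 * (R - 1) * J) - 8 * (R - 1) * R * m * ((R - 1 / 4) * I)
      + 4 * (R - 1) * R\<^sup>2 * m\<^sup>2 * H"
    by (simp add: V_def power2_eq_square field_simps)
  also have "\<dots> = (R - 1 / 4) * 6 * R * m * ((R - 1 / 4) * I)
      + (R - 1 / 4)\<^sup>2 * (2 * R * (W\<^sup>2 - m\<^sup>2) - 3 / 2) * H - 8 * (R - 1) * R * m * ((R - 1 / 4) * I)
      + 4 * (R - 1) * R\<^sup>2 * m\<^sup>2 * H"
    unfolding 2 by (simp add: power2_eq_square field_simps)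
  also have "\<dots> = ((2 * R * W\<^sup>2 - 3 / 2) * (R - 1 / 4)\<^sup>2 + (7 / 2 * R\<^sup>2 - R / 8) * m\<^sup>2) * H"
    unfolding 1 by (simp add: power2_eq_square field_simps)
  also have "\<dots> \<le> 9 / 4 * (R - 1) * R\<^sup>2 * W\<^sup>2 * H"
    using variance mass_nonneg by (intro mult_right_mono)
  also have "\<dots> = (R - 1) * ((3 / 2 * R * W)\<^sup>2 * H)"
    by (simp add: power2_eq_square)
  finally have "V \<le> (3 / 2 * R * W)\<^sup>2 * H"
    using R_ge by simp
  with V show ?thesis by blast
qed

text \<open>The energy vanishes at both ends, so its value at \<open>m\<close> is the integral of
  \<open>q' v\<^sup>2\<close> over the left part and minus that over the right part. Hence twice the
  value is at most the integral of \<open>\<bar>q'\<bar> v\<^sup>2\<close>, which the variance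
  controls.\<close>

lemma energy_center_le: "energy m \<le> 3 / 4 * R * W * H"
proof -
  \<comment> \<open>The bound on the root mean square of \<open>q'\<close>; with this scale both
    halves of the arithmetic-geometric estimate contribute at most
    \<open>\<kappa> / 2 * H\<close>.\<close>
  define \<kappa> where "\<kappa> = 3 / 2 * R * W"
  have \<kappa>: "\<kappa> > 0" using R_ge W_pos by (simp add: \<kappa>_def)
  define y where "y x = 2 * (R - 1 / 4) * x - 2 * R * m" for x
  define f where "f x = ((y x)\<^sup>2 / \<kappa> + \<kappa>) / 2 * (v x)\<^sup>2" for x
  obtain V where V: "((\<lambda>x. (y x)\<^sup>2 * (v x)\<^sup>2) has_integral V) {-1..1}" "V \<le> \<kappa>\<^sup>2 * H"
    using variance_integral unfolding y_def \<kappa>_def by blast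
  have f_ge: "\<bar>y x\<bar> * (v x)\<^sup>2 \<le> f x" for x
  proof -
    have "0 \<le> (\<bar>y x\<bar> - \<kappa>)\<^sup>2" by simp
    then have "2 * \<bar>y x\<bar> * \<kappa> \<le> (y x)\<^sup>2 + \<kappa>\<^sup>2"
      by (simp add: power2_diff)
    then have "\<bar>y x\<bar> \<le> ((y x)\<^sup>2 / \<kappa> + \<kappa>) / 2"
      using \<kappa> by (simp add: field_simps power2_eq_square)
    then show ?thesis
      unfolding f_def by (intro mult_right_mono) auto
  qed
  have fi: "(f has_integral 1 / (2 * \<kappa>) * V + \<kappa> / 2 * H) {-1..1}"
  proof -
    have "f x = 1 / (2 * \<kappa>) * ((y x)\<^sup>2 * (v x)\<^sup>2) + \<kappa> / 2 * (v x)\<^sup>2" for x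
      unfolding f_def using \<kappa> by (simp add: distrib_right add_divide_distrib)
    then have "f = (\<lambda>x. 1 / (2 * \<kappa>) * ((y x)\<^sup>2 * (v x)\<^sup>2) + \<kappa> / 2 * (v x)\<^sup>2)"
      by (rule ext)
    then show ?thesis
      using has_integral_add[OF has_integral_mult_right[OF V(1), of "1 / (2 * \<kappa>)"]
        has_integral_mult_right[OF mass, of "\<kappa> / 2"]] by (simp only:)
  qed
  have fint: "f integrable_on {c..d}" if "-1 \<le> c" "d \<le> 1" for c d
    by (rule integrable_subinterval_real[OF has_integral_integrable[OF fi]]) (use that in auto)
  have ym: "(x / 2 - 2 * R * (x - m)) = - y x" for x
    by (simp add: y_def algebra_simps)
  have "energy m - energy (-1) \<le> integral {-1..m} f"
  proof (rule has_integral_le[OF energy_integral integrable_integral[OF fint]])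
    fix x show "(x / 2 - 2 * R * (x - m)) * (v x)\<^sup>2 \<le> f x"
      unfolding ym by (rule order_trans[OF mult_right_mono f_ge]) auto
  qed (use m_bounds in auto)
  moreover have "- (energy 1 - energy m) \<le> integral {m..1} f"
  proof (rule has_integral_le[OF has_integral_neg[OF energy_integral] integrable_integral[OF fint]])
    fix x show "- ((x / 2 - 2 * R * (x - m)) * (v x)\<^sup>2) \<le> f x"
      unfolding ym by (rule order_trans[OF _ f_ge]) (simp add: mult_right_mono)
  qed (use m_bounds in auto)
  moreover have "integral {-1..m} f + integral {m..1} f = integral {-1..1} f"
    using m_bounds by (intro Henstock_Kurzweil_Integration.integral_combine fint) auto
  moreover have "integral {-1..1} f = 1 / (2 * \<kappa>) * V + \<kappa> / 2 * H"
    using fi by (rule integral_unique)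
  moreover have "1 / (2 * \<kappa>) * V \<le> \<kappa> / 2 * H"
    using V(2) \<kappa> by (simp add: field_simps power2_eq_square)
  ultimately have "2 * energy m \<le> \<kappa> * H"
    by (simp add: energy_ends)
  then show ?thesis by (simp add: \<kappa>_def)
qed

end

section \<open>Sonin's function\<close>

text \<open>The polynomial is \<open>- z ^ 4\<close> times the derivative of \<open>K\<close> below;
  \<open>z \<le> 1 + c\<close> expresses that the point \<open>c - z\<close> is at least -1. Only
  for negative \<open>c\<close> is the linear term dangerous.\<close>

lemma sonin_polynomial_nonneg:
  fixes c z R :: real
  assumes "-1 \<le> c" "c \<le> 1" "0 \<le> z" "z \<le> 1 + c" "R \<ge> 9 / 4"
  defines "S \<equiv> 1 - c\<^sup>2"
  shows "15 / 16 * S\<^sup>2 + 3 / 2 * c * S * z + (1 / 4 - 5 / 8 * S) * z\<^sup>2 + (R - 1 / 16) * z ^ 4 \<ge> 0"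
proof (cases "c \<ge> 0")
  case True
  have "S \<ge> 0" using assms by (simp add: S_def abs_square_le_1 abs_le_iff)
  then have "3 / 2 * c * S * z \<ge> 0" using True assms(3) by simp
  moreover have "(R - 1 / 16) * z ^ 4 \<ge> 35 / 16 * z ^ 4"
    using assms(5) by (intro mult_right_mono) auto
  \<comment> \<open>Completing the square in \<open>S\<close>; \<open>35 / 16\<close> is the least
    value \<open>9 / 4 - 1 / 16\<close> of the leading coefficient.\<close>
  moreover have "15 / 16 * S\<^sup>2 - 5 / 8 * S * z\<^sup>2 + 35 / 16 * z ^ 4
      = 15 / 16 * (S - z\<^sup>2 / 3)\<^sup>2 + 25 / 12 * z ^ 4"
    by (simp add: power2_eq_square field_simps power4_eq_xxxx)
  moreover have "(S - z\<^sup>2 / 3)\<^sup>2 \<ge> 0" "z ^ 4 \<ge> 0" "z\<^sup>2 \<ge> 0" by auto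
  moreover have "(1 / 4 - 5 / 8 * S) * z\<^sup>2 = z\<^sup>2 / 4 - 5 / 8 * S * z\<^sup>2"
    by (simp add: algebra_simps)
  ultimately show ?thesis by linarith
next
  case False
  define w \<zeta> where "w = - c" and "\<zeta> = 1 + c"
  have w: "0 < w" "w \<le> 1" and \<zeta>: "0 \<le> \<zeta>" "z \<le> \<zeta>" using False assms by (auto simp: w_def \<zeta>_def)
  have S: "S = (1 + w) * \<zeta>" by (simp add: S_def w_def \<zeta>_def power2_eq_square algebra_simps)
  define \<kappa> where "\<kappa> = 5 / 8 * w\<^sup>2 - 3 / 8"
  have \<kappa>: "1 / 4 - 5 / 8 * S = \<kappa>" by (simp add: S_def \<kappa>_def w_def field_simps)
  have zz: "z\<^sup>2 \<le> \<zeta> * z" "\<zeta> * z \<le> \<zeta>\<^sup>2" "0 \<le> \<zeta> * z" "0 \<le> z\<^sup>2"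
    using \<zeta> assms(3) by (auto simp: power2_eq_square intro: mult_right_mono mult_left_mono)
  have "0 \<le> 15 / 16 * S\<^sup>2 + 3 / 2 * c * S * z + \<kappa> * z\<^sup>2"
  proof (cases "\<kappa> \<ge> 0")
    case True
    have "3 / 2 * w * (1 + w) * (\<zeta> * z) \<le> 3 / 2 * w * (1 + w) * \<zeta>\<^sup>2"
      using zz w by (intro mult_left_mono) auto
    also have "\<dots> \<le> 15 / 16 * (1 + w) * (1 + w) * \<zeta>\<^sup>2"
      using w by (intro mult_right_mono) (auto simp: algebra_simps)
    finally have "3 / 2 * w * (1 + w) * (\<zeta> * z) \<le> 15 / 16 * (1 + w) * (1 + w) * \<zeta>\<^sup>2" .
    moreover have "\<kappa> * z\<^sup>2 \<ge> 0" using True by simp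
    moreover have "15 / 16 * S\<^sup>2 = 15 / 16 * (1 + w) * (1 + w) * \<zeta>\<^sup>2"
      "3 / 2 * c * S * z = - (3 / 2 * w * (1 + w) * (\<zeta> * z))"
      by (simp_all add: S power2_eq_square w_def)
    ultimately show ?thesis by linarith
  next
    case False
    have "\<kappa> * z\<^sup>2 \<ge> \<kappa> * (\<zeta> * z)"
      using False zz by (intro mult_left_mono_neg) auto
    moreover have "(3 / 2 * w * (1 + w) - \<kappa>) * (\<zeta> * z) \<le> (3 / 2 * w * (1 + w) - \<kappa>) * \<zeta>\<^sup>2"
    proof (intro mult_left_mono)
      have "3 / 2 * w * (1 + w) \<ge> 0" using w by simp
      then show "0 \<le> 3 / 2 * w * (1 + w) - \<kappa>" using False by linarith
    qed (rule zz)
    moreover have "15 / 16 * S\<^sup>2 - (3 / 2 * w * (1 + w) - \<kappa>) * \<zeta>\<^sup>2 = ((3 + w) * \<zeta> / 4)\<^sup>2"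
      by (simp add: S \<kappa>_def power2_eq_square field_simps)
    moreover have "3 / 2 * c * S * z = - (3 / 2 * w * (1 + w) * (\<zeta> * z))"
      by (simp add: S w_def)
    moreover have "((3 + w) * \<zeta> / 4)\<^sup>2 \<ge> 0" by simp
    moreover have "(3 / 2 * w * (1 + w) - \<kappa>) * (\<zeta> * z) = 3 / 2 * w * (1 + w) * (\<zeta> * z) - \<kappa> * (\<zeta> * z)"
      by (rule left_diff_distrib)
    ultimately show ?thesis by linarith
  qed
  moreover have "(R - 1 / 16) * z ^ 4 \<ge> 0" using assms(5) by simp
  ultimately show ?thesis unfolding \<kappa> by linarith
qed

section \<open>The transformed coefficient and the decay of Sonin's function\<close>

context sonin_system
begin

definition c :: real where "c = m + W"
definition S :: real where "S = 1 - c\<^sup>2"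

text \<open>The coefficient of the transformed equation as a function of the distance
  \<open>z = c - x\<close>, expanded in powers of \<open>z\<close> so that its derivative is
  explicit.\<close>

definition K :: "real \<Rightarrow> real" where
  "K z = R * (2 * W - z) + 5 / 16 * S\<^sup>2 / z ^ 3 + 3 / 4 * c * S / z\<^sup>2
       + (1 / 4 - 5 / 8 * S) / z - c / 4 + z / 16"

lemma c_bounds: "-1 < c" "c \<le> 1" "S \<ge> 0"
proof -
  show "-1 < c" "c \<le> 1" using m_bounds W_pos by (auto simp: c_def)
  then show "S \<ge> 0" by (simp add: S_def abs_square_le_1 abs_le_iff)
qed

lemma K_deriv:
  assumes "z > 0"
  shows "(K has_real_derivative
    - (15 / 16 * S\<^sup>2 + 3 / 2 * c * S * z + (1 / 4 - 5 / 8 * S) * z\<^sup>2 + (R - 1 / 16) * z ^ 4) / z ^ 4) (at z)"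
  unfolding K_def using assms
  by (auto intro!: derivative_eq_intros simp: field_simps power2_eq_square power3_eq_cube power4_eq_xxxx)

lemma K_deriv_nonpos:
  assumes "0 < z" "z \<le> 1 + c"
  shows "\<exists>K'\<le>0. (K has_real_derivative K') (at z)"
proof -
  have "15 / 16 * S\<^sup>2 + 3 / 2 * c * S * z + (1 / 4 - 5 / 8 * S) * z\<^sup>2 + (R - 1 / 16) * z ^ 4 \<ge> 0"
    unfolding S_def using assms c_bounds R_ge by (intro sonin_polynomial_nonneg) auto
  then have "- (15 / 16 * S\<^sup>2 + 3 / 2 * c * S * z + (1 / 4 - 5 / 8 * S) * z\<^sup>2 + (R - 1 / 16) * z ^ 4) / z ^ 4 \<le> 0"
    by (intro divide_nonpos_nonneg) auto
  with K_deriv[OF assms(1)] show ?thesis by blast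
qed

text \<open>A form in which every summand is nonnegative for \<open>m \<le> x < c\<close>, which
  gives the sign of \<open>K\<close>.\<close>

lemma K_eq_pos:
  assumes "z \<noteq> 0" "x = c - z"
  shows "z * K z = R * (x - (m - W)) * z + ((1 - x\<^sup>2) / z)\<^sup>2 / 16 + S / z * ((1 - x\<^sup>2) / z) / 4"
proof -
  define p where "p = S / z"
  have S: "S = p * z" using assms(1) by (simp add: p_def)
  have L: "(1 - x\<^sup>2) / z = p + 2 * c - z"
    unfolding assms(2) using assms(1) by (simp add: p_def S_def field_simps power2_eq_square)
  have xm: "x - (m - W) = 2 * W - z" by (simp add: assms(2) c_def)
  have "z * K z = R * (2 * W - z) * z + 5 / 16 * p\<^sup>2 + 3 / 4 * c * p + (1 / 4 - 5 / 8 * S) - c * z / 4 + z\<^sup>2 / 16"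
  proof -
    have "z * (S\<^sup>2 / z ^ 3) = p\<^sup>2" "z * (S / z\<^sup>2) = p"
      using assms(1) by (simp_all add: p_def power2_eq_square power3_eq_cube)
    moreover have "z * K z = R * (2 * W - z) * z + 5 / 16 * (z * (S\<^sup>2 / z ^ 3)) + 3 / 4 * c * (z * (S / z\<^sup>2))
        + z * ((1 / 4 - 5 / 8 * S) / z) - c * z / 4 + z * z / 16"
      by (simp add: K_def algebra_simps)
    ultimately show ?thesis using assms(1) by (simp add: power2_eq_square)
  qed
  \<comment> \<open>Splitting off \<open>c\<^sup>2 / 4\<close> supplies the \<open>c\<^sup>2\<close>
    part of \<open>(p + 2 * c - z)\<^sup>2 / 16\<close>.\<close>
  also have "1 / 4 - 5 / 8 * S = c\<^sup>2 / 4 - 3 / 8 * (p * z)"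
    unfolding S[symmetric] by (simp add: S_def field_simps)
  finally show ?thesis
    unfolding L xm p_def[symmetric] by (simp add: power2_eq_square field_simps)
qed

text \<open>The form in which \<open>K\<close> appears when \<open>aux\<close> is
  differentiated.\<close>

lemma K_eq_q:
  assumes "z \<noteq> 0" "x = c - z"
  shows "z * K z = q x - x * (1 - x\<^sup>2) / (2 * z) + 5 / 16 * (1 - x\<^sup>2)\<^sup>2 / z\<^sup>2"
proof -
  define L where "L = (1 - x\<^sup>2) / z"
  have s: "1 - x\<^sup>2 = z * L" using assms(1) by (simp add: L_def)
  have p: "S / z = L - 2 * c + z"
    unfolding assms(2) L_def using assms(1) by (simp add: S_def field_simps power2_eq_square)
  have e1: "q x = R * (x - (m - W)) * z - z * L / 4"
    unfolding q_def s by (simp add: assms(2) c_def power2_eq_square algebra_simps)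
  have e2: "x * (z * L) / (2 * z) = x * L / 2" "5 / 16 * (z * L)\<^sup>2 / z\<^sup>2 = 5 / 16 * L\<^sup>2"
    using assms(1) by (simp_all add: power_mult_distrib)
  have "L\<^sup>2 / 16 + (L - 2 * c + z) * L / 4 = - z * L / 4 - x * L / 2 + 5 / 16 * L\<^sup>2"
    unfolding assms(2) by (simp add: power2_eq_square field_simps)
  then show ?thesis
    unfolding K_eq_pos[OF assms] L_def[symmetric] p unfolding s e1 e2 by simp
qed

lemma K_pos:
  assumes "m \<le> x" "x < c"
  shows "K (c - x) > 0"
proof -
  have x: "x \<in> {-1<..<1}" using assms m_bounds c_bounds by auto
  have "(c - x) * K (c - x) > 0"
    using assms W_pos R_ge c_bounds one_minus_square_pos[OF x]
    by (subst K_eq_pos[of _ x]) (auto intro!: add_pos_nonneg mult_pos_pos)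
  then show ?thesis using assms by (simp add: zero_less_mult_iff)
qed

text \<open>Up to the factor \<open>(c - x) powr (1/4)\<close>, this is \<open>1 - x\<^sup>2\<close>
  times the derivative of \<open>(c - x) powr (1/4) * v x\<close>.\<close>

definition aux :: "real \<Rightarrow> real" where
  "aux x = u x - (1 - x\<^sup>2) / (4 * (c - x)) * v x"

text \<open>Sonin's function for the multiplier \<open>(c - x) powr (-1/2)\<close>. In the independent variable and
  scaling in which this multiplier becomes constant, the equation is \<open>y'' + K y = 0\<close>, so that
  \<open>sonin\<close> is \<open>y\<^sup>2 + y'\<^sup>2 / K\<close> and its monotonicity is that of \<open>K\<close>.\<close>
definition sonin :: "real \<Rightarrow> real" where
  "sonin x = sqrt (c - x) * (v x)\<^sup>2 + (aux x)\<^sup>2 / (sqrt (c - x) * K (c - x))"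

lemma aux_deriv:
  assumes "m \<le> x" "x < c"
  shows "(aux has_real_derivative
     - aux x / (4 * (c - x)) - (c - x) * K (c - x) / (1 - x\<^sup>2) * v x) (at x)"
proof -
  have x: "x \<in> {-1<..<1}" using assms m_bounds c_bounds by auto
  have s: "1 - x\<^sup>2 \<noteq> 0" using one_minus_square_pos[OF x] by simp
  have z: "c - x \<noteq> 0" using assms by simp
  have KQ: "(c - x) * K (c - x)
      = q x - x * (1 - x\<^sup>2) / (2 * (c - x)) + 5 / 16 * (1 - x\<^sup>2)\<^sup>2 / (c - x)\<^sup>2"
    by (rule K_eq_q[OF z]) simp
  have "((\<lambda>x. (1 - x\<^sup>2) / (4 * (c - x))) has_real_derivative
      - x / (2 * (c - x)) + (1 - x\<^sup>2) / (4 * (c - x)\<^sup>2)) (at x)"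
  proof (rule DERIV_cong)
    show "((\<lambda>x. (1 - x\<^sup>2) / (4 * (c - x))) has_real_derivative
        (- 2 * x * (4 * (c - x)) - (1 - x\<^sup>2) * - 4) / (4 * (c - x) * (4 * (c - x)))) (at x)"
      using z by (intro DERIV_divide) (auto intro!: derivative_eq_intros)
    have "(- 2 * x * (4 * z) - \<sigma> * - 4) / (4 * z * (4 * z)) = - x / (2 * z) + \<sigma> / (4 * z\<^sup>2)"
      if "z \<noteq> 0" for z \<sigma> :: real
      using that by (simp add: field_simps power2_eq_square)
    from this[OF z] show "(- 2 * x * (4 * (c - x)) - (1 - x\<^sup>2) * - 4) / (4 * (c - x) * (4 * (c - x)))
        = - x / (2 * (c - x)) + (1 - x\<^sup>2) / (4 * (c - x)\<^sup>2)" .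
  qed
  from DERIV_diff[OF u_deriv_q[OF x] DERIV_mult[OF this v_deriv[OF x]]]
  show ?thesis
    unfolding aux_def
  proof (rule DERIV_cong)
    have "- Q * V / \<sigma> - ((- x / (2 * z) + \<sigma> / (4 * z\<^sup>2)) * V + U / \<sigma> * (\<sigma> / (4 * z)))
      = - (U - \<sigma> / (4 * z) * V) / (4 * z) - (Q - x * \<sigma> / (2 * z) + 5 / 16 * \<sigma>\<^sup>2 / z\<^sup>2) / \<sigma> * V"
      if "\<sigma> \<noteq> 0" "z \<noteq> 0" for Q V U \<sigma> z
      using that by (simp add: field_simps power2_eq_square)
    from this[OF s z]
    show "- q x * v x / (1 - x\<^sup>2)
       - ((- x / (2 * (c - x)) + (1 - x\<^sup>2) / (4 * (c - x)\<^sup>2)) * v x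
          + u x / (1 - x\<^sup>2) * ((1 - x\<^sup>2) / (4 * (c - x))))
      = - (u x - (1 - x\<^sup>2) / (4 * (c - x)) * v x) / (4 * (c - x)) - (c - x) * K (c - x) / (1 - x\<^sup>2) * v x"
      unfolding KQ .
  qed
qed

text \<open>Everything cancels except the term with the derivative of \<open>K\<close>.
  \<open>K\<close> decreases in \<open>z = c - x\<close>, hence grows with \<open>x\<close>.\<close>

lemma sonin_deriv_nonpos:
  assumes "m \<le> x" "x < c"
  shows "\<exists>D\<le>0. (sonin has_real_derivative D) (at x)"
proof -
  have x: "x \<in> {-1<..<1}" using assms m_bounds c_bounds by auto
  have s: "1 - x\<^sup>2 \<noteq> 0" using one_minus_square_pos[OF x] by simp
  \<comment> \<open>With \<open>t\<close> as variable the derivative becomes rational.\<close>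
  define t where "t = sqrt (c - x)"
  have t: "t > 0" "c - x = t\<^sup>2" using assms by (auto simp: t_def)
  have K: "K (t\<^sup>2) > 0" using K_pos[OF assms] t by simp
  obtain K' where K': "K' \<le> 0" "(K has_real_derivative K') (at (c - x))"
    using K_deriv_nonpos[of "c - x"] assms x by auto
  have dK: "((\<lambda>x. K (c - x)) has_real_derivative K' * - 1) (at x)"
    by (rule DERIV_chain2[where f = K and g = "\<lambda>x. c - x", OF K'(2)]) (auto intro!: derivative_eq_intros)
  have dt: "((\<lambda>x. sqrt (c - x)) has_real_derivative - 1 / (2 * t)) (at x)"
    using assms by (auto intro!: derivative_eq_intros simp: t_def field_simps)
  have u: "u x = aux x + (1 - x\<^sup>2) / (4 * t\<^sup>2) * v x"
    by (simp add: aux_def t)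
  have "(sonin has_real_derivative (aux x)\<^sup>2 * K' / (t * (K (t\<^sup>2))\<^sup>2)) (at x)"
    unfolding sonin_def
  proof (rule DERIV_cong)
    have dv: "((\<lambda>x. (v x)\<^sup>2) has_real_derivative 2 * v x * (u x / (1 - x\<^sup>2))) (at x)"
      by (rule DERIV_cong[OF DERIV_power[OF v_deriv[OF x], of 2]]) simp
    have da: "((\<lambda>x. (aux x)\<^sup>2) has_real_derivative
        2 * aux x * (- aux x / (4 * t\<^sup>2) - t\<^sup>2 * K (t\<^sup>2) / (1 - x\<^sup>2) * v x)) (at x)"
      by (rule DERIV_cong[OF DERIV_power[OF aux_deriv[OF assms], of 2]]) (simp add: t(2))
    have st: "sqrt (t\<^sup>2) = t" using t(1) by simp
    have ne: "sqrt (c - x) * K (c - x) \<noteq> 0"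
      using K_pos[OF assms] assms by simp
    show "((\<lambda>x. sqrt (c - x) * (v x)\<^sup>2 + (aux x)\<^sup>2 / (sqrt (c - x) * K (c - x))) has_real_derivative
       (- 1 / (2 * t) * (v x)\<^sup>2 + 2 * v x * (u x / (1 - x\<^sup>2)) * t)
       + (2 * aux x * (- aux x / (4 * t\<^sup>2) - t\<^sup>2 * K (t\<^sup>2) / (1 - x\<^sup>2) * v x) * (t * K (t\<^sup>2))
          - (aux x)\<^sup>2 * (- 1 / (2 * t) * K (t\<^sup>2) + K' * - 1 * t)) / (t * K (t\<^sup>2))\<^sup>2) (at x)"
      by (rule DERIV_cong[OF DERIV_add[OF DERIV_mult[OF dt dv] DERIV_divide[OF da DERIV_mult[OF dt dK] ne]]])
         (simp only: t(2) st power2_eq_square[of "t * K (t\<^sup>2)"])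
    have "(- 1 / (2 * t) * V\<^sup>2 + 2 * V * ((y + \<sigma> / (4 * t\<^sup>2) * V) / \<sigma>) * t)
       + (2 * y * (- y / (4 * t\<^sup>2) - t\<^sup>2 * k / \<sigma> * V) * (t * k)
          - y\<^sup>2 * (- 1 / (2 * t) * k + K' * - 1 * t)) / (t * k)\<^sup>2 = y\<^sup>2 * K' / (t * k\<^sup>2)"
      if "k \<noteq> 0" "\<sigma> \<noteq> 0" for V y \<sigma> k
      using that t(1) by (simp add: field_simps power2_eq_square)
    from this[OF _ s] K
    show "(- 1 / (2 * t) * (v x)\<^sup>2 + 2 * v x * (u x / (1 - x\<^sup>2)) * t)
       + (2 * aux x * (- aux x / (4 * t\<^sup>2) - t\<^sup>2 * K (t\<^sup>2) / (1 - x\<^sup>2) * v x) * (t * K (t\<^sup>2))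
          - (aux x)\<^sup>2 * (- 1 / (2 * t) * K (t\<^sup>2) + K' * - 1 * t)) / (t * K (t\<^sup>2))\<^sup>2
       = (aux x)\<^sup>2 * K' / (t * (K (t\<^sup>2))\<^sup>2)"
      unfolding u by auto
  qed
  moreover have "(aux x)\<^sup>2 * K' / (t * (K (t\<^sup>2))\<^sup>2) \<le> 0"
    using K'(1) t(1) by (intro divide_nonpos_nonneg mult_nonneg_nonpos) auto
  ultimately show ?thesis by blast
qed

text \<open>Both sides are quadratic forms in \<open>u m\<close> and \<open>v m\<close>. The
  constant \<open>63 / 50\<close> lies just below \<open>4 / sqrt 10\<close>, the largest value that
  the final numerical comparison tolerates.\<close>

lemma sonin_center_le: "sonin m \<le> sqrt W * (63 / (50 * (R * W\<^sup>2)) * energy m)"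
proof -
  define \<Phi> where "\<Phi> = R * W\<^sup>2"
  define T where "T = 1 - m\<^sup>2"
  define \<eta> where "\<eta> = T / (4 * W)"
  have \<Phi>: "\<Phi> > 0" using R_ge W_pos by (simp add: \<Phi>_def)
  have T: "T > 0" unfolding T_def using m_bounds by (intro one_minus_square_pos) auto
  have "W\<^sup>2 \<le> (1 - \<bar>m\<bar>)\<^sup>2" using mW W_pos by (intro power_mono) auto
  also have "\<dots> \<le> T"
  proof -
    have "m\<^sup>2 = \<bar>m\<bar> * \<bar>m\<bar>" by (simp add: power2_eq_square)
    moreover have "\<bar>m\<bar> * \<bar>m\<bar> \<le> \<bar>m\<bar> * 1" using m_bounds by (intro mult_left_mono) auto
    ultimately show ?thesis by (simp add: T_def power2_eq_square algebra_simps)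
  qed
  finally have WT: "W\<^sup>2 \<le> T" .
  have RW: "\<Phi> * W\<^sup>2 \<ge> 9 / 4 * T\<^sup>2"
    using RW4 by (simp add: \<Phi>_def T_def power2_eq_square power4_eq_xxxx mult_ac)
  \<comment> \<open>\<open>RW4\<close> rescaled: the shift \<open>\<eta>\<close> in
    \<open>aux m\<close> is small against \<open>sqrt \<Phi>\<close>.\<close>
  have \<eta>2: "36 * \<eta>\<^sup>2 \<le> \<Phi>"
    using RW W_pos by (simp add: \<eta>_def power_divide power_mult_distrib field_simps)
  have "9 / 4 * T * W\<^sup>2 \<le> 9 / 4 * T * T"
    using WT T by (intro mult_left_mono) auto
  then have "9 / 4 * T * W\<^sup>2 \<le> \<Phi> * W\<^sup>2"
    using RW by (simp add: power2_eq_square)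
  then have "9 / 4 * T \<le> \<Phi>"
    using W_pos by simp
  then have qm: "q m \<ge> 8 / 9 * \<Phi>"
    by (simp add: q_def \<Phi>_def T_def)
  have "W * K W = \<Phi> + \<eta>\<^sup>2 + S / W * (T / W) / 4"
    using W_pos by (subst K_eq_pos[of _ m])
      (auto simp: c_def \<Phi>_def T_def \<eta>_def power_divide power_mult_distrib power2_eq_square)
  then have KW: "W * K W \<ge> \<Phi> + \<eta>\<^sup>2"
    using c_bounds T W_pos by simp
  have K0: "K W > 0" using K_pos[of m] W_pos by (simp add: c_def)
  define y where "y = u m - \<eta> * v m"
  have aux: "aux m = y"
    by (simp add: aux_def c_def y_def \<eta>_def T_def)
  have "sonin m = sqrt W * ((v m)\<^sup>2 + y\<^sup>2 / (W * K W))"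
  proof -
    have "t * (V + Y / (t * t * k)) = t * V + Y / (t * k)" if "t \<noteq> 0" for t V Y k :: real
      using that by (simp add: distrib_left)
    from this[of "sqrt W"] have "sqrt W * (V + Y / (W * k)) = sqrt W * V + Y / (sqrt W * k)" for V Y k
      using W_pos by simp
    then show ?thesis by (simp add: sonin_def aux c_def)
  qed
  also have "\<dots> \<le> sqrt W * ((v m)\<^sup>2 + y\<^sup>2 / (\<Phi> + \<eta>\<^sup>2))"
    using W_pos KW \<Phi> K0 by (intro mult_left_mono add_left_mono divide_left_mono) (auto intro!: mult_pos_pos add_pos_nonneg)
  also have "\<dots> \<le> sqrt W * (63 / (50 * \<Phi>) * energy m)"
  proof (intro mult_left_mono)
    have "(v m)\<^sup>2 + y\<^sup>2 / (\<Phi> + \<eta>\<^sup>2) \<le> 63 / (50 * \<Phi>) * ((u m)\<^sup>2 + 8 / 9 * \<Phi> * (v m)\<^sup>2)"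
    proof -
      \<comment> \<open>Clearing denominators leaves the form with coefficients \<open>A\<close>,
        \<open>2 * \<Phi> * \<eta>\<close>, \<open>C\<close>; it is nonnegative since
        \<open>A > 0\<close> and \<open>A * C \<ge> (\<Phi> * \<eta>)\<^sup>2\<close>.\<close>
      define A where "A = 13 / 50 * \<Phi> + 63 / 50 * \<eta>\<^sup>2"
      define C where "C = 3 / 25 * \<Phi>\<^sup>2 - 22 / 25 * \<Phi> * \<eta>\<^sup>2"
      have A: "A > 0" using \<Phi> by (simp add: A_def add_pos_nonneg)
      have "A * C - (\<Phi> * \<eta>)\<^sup>2 = \<Phi> * (39 / 1250 * \<Phi>\<^sup>2 - 1347 / 1250 * \<Phi> * \<eta>\<^sup>2 - 1386 / 1250 * (\<eta>\<^sup>2)\<^sup>2)"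
        by (simp add: A_def C_def power2_eq_square field_simps)
      moreover have "39 / 1250 * \<Phi>\<^sup>2 - 1347 / 1250 * \<Phi> * \<eta>\<^sup>2 - 1386 / 1250 * (\<eta>\<^sup>2)\<^sup>2 \<ge> 0"
      proof -
        have "36 * (\<Phi> * \<eta>\<^sup>2) \<le> \<Phi>\<^sup>2"
          using mult_left_mono[OF \<eta>2, of \<Phi>] \<Phi> by (simp add: power2_eq_square mult_ac)
        moreover have "1296 * (\<eta>\<^sup>2)\<^sup>2 \<le> \<Phi>\<^sup>2"
          using power_mono[OF \<eta>2, of 2] by (simp add: power_mult_distrib)
        moreover have "\<Phi>\<^sup>2 \<ge> 0" by simp
        moreover have "0 \<le> 39 / 1250 * p - 1347 / 1250 * x - 1386 / 1250 * e"
          if "36 * x \<le> p" "1296 * e \<le> p" "p \<ge> 0" for p x e :: real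
          using that by linarith
        ultimately show ?thesis unfolding mult.assoc by blast
      qed
      ultimately have "A * C - (\<Phi> * \<eta>)\<^sup>2 \<ge> 0" using \<Phi> by simp
      then have "0 \<le> (A * u m + \<Phi> * \<eta> * v m)\<^sup>2 + (A * C - (\<Phi> * \<eta>)\<^sup>2) * (v m)\<^sup>2"
        by simp
      also have "\<dots> = A * (A * (u m)\<^sup>2 + 2 * \<Phi> * \<eta> * u m * v m + C * (v m)\<^sup>2)"
        by (simp add: power2_eq_square algebra_simps)
      finally have "0 \<le> A * (u m)\<^sup>2 + 2 * \<Phi> * \<eta> * u m * v m + C * (v m)\<^sup>2"
        using A by (simp add: zero_le_mult_iff)
      then have "\<Phi> * (\<Phi> + \<eta>\<^sup>2) * (v m)\<^sup>2 + \<Phi> * y\<^sup>2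
          \<le> 63 / 50 * (\<Phi> + \<eta>\<^sup>2) * ((u m)\<^sup>2 + 8 / 9 * \<Phi> * (v m)\<^sup>2)"
        by (simp add: A_def C_def y_def power2_eq_square algebra_simps)
      moreover have "\<Phi> + \<eta>\<^sup>2 > 0" using \<Phi> by (simp add: add_pos_nonneg)
      moreover have "V + Y / D \<le> 63 / (50 * \<Phi>) * E"
        if "\<Phi> * D * V + \<Phi> * Y \<le> 63 / 50 * D * E" "D > 0" for V Y D E
        using that \<Phi> by (simp add: field_simps)
      ultimately show ?thesis by blast
    qed
    also have "\<dots> \<le> 63 / (50 * \<Phi>) * energy m"
      unfolding energy_def using qm \<Phi> by (intro mult_left_mono add_left_mono mult_right_mono) auto
    finally show "(v m)\<^sup>2 + y\<^sup>2 / (\<Phi> + \<eta>\<^sup>2) \<le> 63 / (50 * \<Phi>) * energy m" .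
  qed (use W_pos in simp)
  finally show ?thesis by (simp add: \<Phi>_def)
qed

lemma sonin_bound:
  assumes "m \<le> x" "x \<le> m + W"
  shows "sqrt ((x - (m - W)) * (m + W - x)) * (v x)\<^sup>2 \<le> sqrt 2 * (189 / 200) * H"
\<comment> \<open>At the right end the claim is trivial, while the denominator in
  \<open>sonin\<close> is zero.\<close>
proof (cases "x = m + W")
  case True
  then show ?thesis using mass_nonneg by simp
next
  case False
  then have x: "x < c" using assms by (simp add: c_def)
  have "sonin x \<le> sonin m"
  proof (rule DERIV_nonpos_imp_nonincreasing[OF assms(1)])
    fix y assume "m \<le> y" "y \<le> x"
    then show "\<exists>D. (sonin has_real_derivative D) (at y) \<and> D \<le> 0"
      using sonin_deriv_nonpos[of y] x by auto
  qed
  moreover have "sqrt (c - x) * (v x)\<^sup>2 \<le> sonin x"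
    using K_pos[OF assms(1) x] x by (simp add: sonin_def)
  moreover have "sonin m \<le> sqrt W * (63 / (50 * (R * W\<^sup>2)) * (3 / 4 * R * W * H))"
    using R_ge W_pos
    by (intro order_trans[OF sonin_center_le] mult_left_mono energy_center_le) auto
  ultimately have 1: "sqrt (c - x) * (v x)\<^sup>2 \<le> sqrt W * (63 / (50 * (R * W\<^sup>2)) * (3 / 4 * R * W * H))"
    by linarith
  have "sqrt ((x - (m - W)) * (m + W - x)) * (v x)\<^sup>2 = sqrt (x - (m - W)) * (sqrt (c - x) * (v x)\<^sup>2)"
    by (simp add: real_sqrt_mult c_def)
  also have "\<dots> \<le> sqrt (2 * W) * (sqrt W * (63 / (50 * (R * W\<^sup>2)) * (3 / 4 * R * W * H)))"
    using assms x W_pos by (intro mult_mono 1) auto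
  also have "\<dots> = sqrt 2 * (189 / 200) * H"
  proof -
    have "sqrt (2 * W) * sqrt W = sqrt 2 * W" using W_pos by (simp add: real_sqrt_mult)
    then have e: "sqrt (2 * W) * (sqrt W * Y) = sqrt 2 * (W * Y)" for Y
      by (simp only: mult.assoc[symmetric])
    have f: "W * (63 / (50 * (R * W\<^sup>2)) * (3 / 4 * R * W * H)) = 189 / 200 * H"
      using W_pos R_ge by (simp add: field_simps power2_eq_square)
    show ?thesis unfolding e f by (simp only: mult.assoc)
  qed
  finally show ?thesis .
qed

end

section \<open>The bound for Jacobi polynomials\<close>

text \<open>With \<open>A = (a + b) / r\<close> and \<open>B = \<bar>a - b\<bar> / r\<close> one has
  \<open>\<bar>m\<bar> = A * B\<close> and
  \<open>W\<^sup>2 = (1 - A\<^sup>2) * (1 - B\<^sup>2)\<close>, so the claims become polynomial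
  relations on \<open>0 \<le> B \<le> A < 1\<close>. The hypothesis on \<open>r\<close>, that is
  \<open>k \<ge> 1\<close>, turns into \<open>r * (1 - A) \<ge> 3\<close>.\<close>

lemma jacobi_parameters:
  fixes a b r :: real
  assumes a: "a \<ge> 0" and b: "b \<ge> 0" and r: "r \<ge> a + b + 3"
  defines "R \<equiv> r\<^sup>2 / 4" and "m \<equiv> (b\<^sup>2 - a\<^sup>2) / r\<^sup>2"
    and "W \<equiv> sqrt ((r\<^sup>2 - (a + b)\<^sup>2) * (r\<^sup>2 - (a - b)\<^sup>2)) / r\<^sup>2"
  shows "W > 0" "\<bar>m\<bar> + W \<le> 1" "R \<ge> 9 / 4" "R * W ^ 4 \<ge> 9 / 4 * (1 - m\<^sup>2)\<^sup>2"
    "(2 * R * W\<^sup>2 - 3 / 2) * (R - 1 / 4)\<^sup>2 + (7 / 2 * R\<^sup>2 - R / 8) * m\<^sup>2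
        \<le> 9 / 4 * (R - 1) * R\<^sup>2 * W\<^sup>2"
    "R * (W\<^sup>2 - (x - m)\<^sup>2) = R * (1 - x\<^sup>2) - (a\<^sup>2 * (1 + x) + b\<^sup>2 * (1 - x)) / 2"
proof -
  have r0: "r > 0" using assms(1-3) by simp
  define A B where "A = (a + b) / r" and "B = \<bar>a - b\<bar> / r"
  have "r * (1 - A) = r - (a + b)" using r0 by (simp add: A_def field_simps)
  then have rA: "r * (1 - A) \<ge> 3" using r by simp
  have AB: "0 \<le> B" "B \<le> A" "A < 1"
    using a b r r0 by (auto simp: A_def B_def divide_right_mono)
  have A0: "0 \<le> A" using AB by simp
  have B2: "B\<^sup>2 \<le> A\<^sup>2" using AB by (intro power_mono) auto
  have A2: "A\<^sup>2 < 1" using AB A0 by (simp add: abs_square_less_1)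
  have AB0: "(1 - A\<^sup>2) * (1 - B\<^sup>2) > 0" using A2 B2 by simp
  have "r\<^sup>2 - (a + b)\<^sup>2 = r\<^sup>2 * (1 - A\<^sup>2)" "r\<^sup>2 - (a - b)\<^sup>2 = r\<^sup>2 * (1 - B\<^sup>2)"
    using r0 by (simp_all add: A_def B_def power_divide right_diff_distrib)
  then have "(r\<^sup>2 - (a + b)\<^sup>2) * (r\<^sup>2 - (a - b)\<^sup>2) = (r\<^sup>2)\<^sup>2 * ((1 - A\<^sup>2) * (1 - B\<^sup>2))"
    by (simp only: power2_eq_square[of "r\<^sup>2"] mult_ac)
  then have "sqrt ((r\<^sup>2 - (a + b)\<^sup>2) * (r\<^sup>2 - (a - b)\<^sup>2)) = r\<^sup>2 * sqrt ((1 - A\<^sup>2) * (1 - B\<^sup>2))"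
    by (simp only: real_sqrt_mult[of "(r\<^sup>2)\<^sup>2"] real_sqrt_abs abs_power2)
  then have W_eq: "W = sqrt ((1 - A\<^sup>2) * (1 - B\<^sup>2))"
    using r0 by (simp add: W_def)
  then have W2: "W\<^sup>2 = (1 - A\<^sup>2) * (1 - B\<^sup>2)"
    using AB0 by simp
  show "W > 0" unfolding W_eq using AB0 by (rule real_sqrt_gt_zero)
  have m: "\<bar>m\<bar> = A * B"
  proof -
    have "m = - ((a + b) * (a - b)) / r\<^sup>2" by (simp add: m_def power2_eq_square algebra_simps)
    then show ?thesis using a b by (simp add: A_def B_def abs_mult power2_eq_square)
  qed
  have m2: "m\<^sup>2 = A\<^sup>2 * B\<^sup>2" using arg_cong[OF m, of "\<lambda>t. t\<^sup>2"] by (simp add: power_mult_distrib)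
  have AB1: "A * B \<le> 1" using AB A0 by (simp add: mult_le_one)
  have "(1 - A * B)\<^sup>2 - W\<^sup>2 = (A - B)\<^sup>2"
    unfolding W2 by (simp add: power2_eq_square algebra_simps)
  then have "W\<^sup>2 \<le> (1 - A * B)\<^sup>2" by (smt (verit) zero_le_power2)
  then have "W \<le> 1 - A * B" by (rule power2_le_imp_le) (use AB1 in simp)
  then show "\<bar>m\<bar> + W \<le> 1" using m by simp
  have "(r * (1 - A))\<^sup>2 \<ge> 3\<^sup>2" using rA by (intro power_mono) auto
  then have RA: "R * (1 - A)\<^sup>2 \<ge> 9 / 4" by (simp add: R_def power_mult_distrib)
  have "r\<^sup>2 \<ge> 3\<^sup>2" using a b r by (intro power_mono) auto
  then show R: "R \<ge> 9 / 4" by (simp add: R_def)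
  show "R * W ^ 4 \<ge> 9 / 4 * (1 - m\<^sup>2)\<^sup>2"
  proof -
    have "(1 + A) * (1 - B\<^sup>2) - (1 - A\<^sup>2 * B\<^sup>2) = A * (1 - A) * (1 - A\<^sup>2) + (A\<^sup>2 - B\<^sup>2) * (1 + A * (1 - A))"
      by (simp add: power2_eq_square algebra_simps)
    moreover have "\<dots> \<ge> 0" using AB A0 A2 B2 by (intro add_nonneg_nonneg mult_nonneg_nonneg) auto
    ultimately have "1 - m\<^sup>2 \<le> (1 + A) * (1 - B\<^sup>2)" by (simp add: m2)
    moreover have "1 - m\<^sup>2 \<ge> 0"
      using AB1 m AB A0 by (simp add: abs_square_le_1)
    ultimately have "(1 - m\<^sup>2)\<^sup>2 \<le> ((1 + A) * (1 - B\<^sup>2))\<^sup>2" by (intro power_mono)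
    then have "9 / 4 * (1 - m\<^sup>2)\<^sup>2 \<le> R * (1 - A)\<^sup>2 * ((1 + A) * (1 - B\<^sup>2))\<^sup>2"
      using RA by (intro mult_mono) auto
    also have "\<dots> = R * (W\<^sup>2)\<^sup>2"
      unfolding W2 by (simp add: power2_eq_square algebra_simps)
    finally show ?thesis by (simp flip: power_mult)
  qed
  show "(2 * R * W\<^sup>2 - 3 / 2) * (R - 1 / 4)\<^sup>2 + (7 / 2 * R\<^sup>2 - R / 8) * m\<^sup>2
        \<le> 9 / 4 * (R - 1) * R\<^sup>2 * W\<^sup>2"
  proof -
    define w where "w = W\<^sup>2"
    \<comment> \<open>\<open>L\<close> collects the factor of \<open>R\<^sup>2\<close> in the
      difference of the two sides; it suffices that \<open>R * L \<ge> 1\<close>.\<close>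
    define L where "L = R * w / 4 - 5 / 4 * w + 3 / 2 - 7 / 2 * m\<^sup>2"
    have w1: "w \<le> 1 - A\<^sup>2" "w \<ge> 0"
      using A2 B2 mult_left_mono[of "1 - B\<^sup>2" 1 "1 - A\<^sup>2"] by (auto simp: w_def W2)
    have m1: "m\<^sup>2 \<le> A\<^sup>2" unfolding m2 using A2 B2 mult_left_mono[of "B\<^sup>2" 1 "A\<^sup>2"] by simp
    \<comment> \<open>Since \<open>B \<le> A\<close>, \<open>w\<close> is at least
      \<open>(1 - A\<^sup>2)\<^sup>2\<close>.\<close>
    have "9 / 4 * (1 + A)\<^sup>2 \<le> R * (1 - A)\<^sup>2 * (1 + A)\<^sup>2"
      using RA by (intro mult_right_mono) auto
    also have "\<dots> = R * ((1 - A\<^sup>2) * (1 - A\<^sup>2))"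
      by (simp add: power2_eq_square algebra_simps)
    also have "\<dots> \<le> R * ((1 - A\<^sup>2) * (1 - B\<^sup>2))"
      using A2 B2 R by (intro mult_left_mono) auto
    finally have "R * w \<ge> 9 / 4 * (1 + A)\<^sup>2" by (simp add: w_def W2)
    then have "L \<ge> 9 / 16 * (1 + A)\<^sup>2 - 5 / 4 * (1 - A\<^sup>2) + 3 / 2 - 7 / 2 * A\<^sup>2"
    proof -
      have "9 / 16 * p - 5 / 4 * (1 - t) + 3 / 2 - 7 / 2 * t \<le> z / 4 - 5 / 4 * w + 3 / 2 - 7 / 2 * n"
        if "9 / 4 * p \<le> z" "w \<le> 1 - t" "n \<le> t" for p t z n :: real
        using that by argo
      then show ?thesis
        using \<open>R * w \<ge> 9 / 4 * (1 + A)\<^sup>2\<close> w1(1) m1 unfolding L_def .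
    qed
    also have "9 / 16 * (1 + A)\<^sup>2 - 5 / 4 * (1 - A\<^sup>2) + 3 / 2 - 7 / 2 * A\<^sup>2
        = 1 / 4 + 9 / 16 * (1 - A)\<^sup>2 + 9 / 4 * A * (1 - A)"
      by (simp add: power2_eq_square field_simps)
    finally have "1 / 4 + 9 / 16 * (1 - A)\<^sup>2 + 9 / 4 * A * (1 - A) \<le> L" .
    moreover have "9 / 4 * A * (1 - A) \<ge> 0" using A0 AB by simp
    ultimately have L: "L \<ge> 1 / 4 + 9 / 16 * (1 - A)\<^sup>2" by linarith
    have "R * L \<ge> R * (1 / 4 + 9 / 16 * (1 - A)\<^sup>2)"
      using L R by (intro mult_left_mono) auto
    then have "R * L \<ge> 1" using R RA by (simp add: algebra_simps)
    moreover have "w \<le> 1" using w1 zero_le_power2[of A] by linarith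
    ultimately have "R * L - w / 8 - 3 / 4 \<ge> 0" by simp
    then have "0 \<le> R * (R * L - w / 8 - 3 / 4) + 3 / 32 + R / 8 * m\<^sup>2"
      using R by (intro add_nonneg_nonneg mult_nonneg_nonneg) auto
    also have "\<dots> = 9 / 4 * (R - 1) * R\<^sup>2 * w
        - ((2 * R * w - 3 / 2) * (R - 1 / 4)\<^sup>2 + (7 / 2 * R\<^sup>2 - R / 8) * m\<^sup>2)"
      by (simp add: L_def power2_eq_square field_simps)
    finally show ?thesis by (simp add: w_def)
  qed
  show "R * (W\<^sup>2 - (x - m)\<^sup>2) = R * (1 - x\<^sup>2) - (a\<^sup>2 * (1 + x) + b\<^sup>2 * (1 - x)) / 2"
  proof -
    have e1: "W\<^sup>2 - m\<^sup>2 = 1 - (A\<^sup>2 + B\<^sup>2)" by (simp add: W2 m2 algebra_simps)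
    have e2: "R * (A\<^sup>2 + B\<^sup>2) = (a\<^sup>2 + b\<^sup>2) / 2"
      using r0 by (simp add: R_def A_def B_def power_divide field_simps) (simp add: power2_eq_square algebra_simps)
    have e3: "R * m = (b\<^sup>2 - a\<^sup>2) / 4"
      using r0 by (simp add: R_def m_def)
    have "R * (W\<^sup>2 - (x - m)\<^sup>2) = R * (W\<^sup>2 - m\<^sup>2) - R * x\<^sup>2 + 2 * x * (R * m)"
      by (simp add: power2_eq_square algebra_simps)
    then show ?thesis
      unfolding e1 e3 right_diff_distrib e2 by (simp add: field_simps)
  qed
qed

text \<open>The first and last factors under the root multiply to
  \<open>r\<^sup>2 - (a + b)\<^sup>2\<close>, the middle two to
  \<open>r\<^sup>2 - (a - b)\<^sup>2\<close>.\<close>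

lemma delta_pm_eq:
  fixes a b :: real
  defines "r k \<equiv> 2 * real k + a + b + 1"
  shows "delta_pm \<epsilon> k a b = (b\<^sup>2 - a\<^sup>2) / (r k)\<^sup>2
    + \<epsilon> * (sqrt (((r k)\<^sup>2 - (a + b)\<^sup>2) * ((r k)\<^sup>2 - (a - b)\<^sup>2)) / (r k)\<^sup>2)"
proof -
  have "(2*real k+1) * (2*real k+2*a+1) * (2*real k+2*b+1) * (2*real k+2*a+2*b+1)
      = ((r k)\<^sup>2 - (a + b)\<^sup>2) * ((r k)\<^sup>2 - (a - b)\<^sup>2)"
    by (simp add: r_def power2_eq_square algebra_simps)
  then show ?thesis
    unfolding delta_pm_def r_def by (simp add: add_divide_distrib)
qed

lemma delta_pm_swap: "delta_pm \<epsilon> k b a = - delta_pm (- \<epsilon>) k a b"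
proof -
  have e: "2 * real k + b + a + 1 = 2 * real k + a + b + 1" "(b - a)\<^sup>2 = (a - b)\<^sup>2" "b + a = a + b"
    by (simp_all add: power2_commute)
  show ?thesis
    unfolding delta_pm_eq e by (simp add: diff_divide_distrib)
qed

lemma jacobi_sonin_system:
  fixes a b :: real
  assumes k: "k \<ge> 1" and a: "a \<ge> 0" and b: "b \<ge> 0"
  defines "r \<equiv> 2 * real k + a + b + 1"
  shows "sonin_system (jacobi_fun k a b) (jacobi_flux k a b) (r\<^sup>2 / 4) ((b\<^sup>2 - a\<^sup>2) / r\<^sup>2)
    (sqrt ((r\<^sup>2 - (a + b)\<^sup>2) * (r\<^sup>2 - (a - b)\<^sup>2)) / r\<^sup>2) (jacobi_hsq k a b)"
proof -
  have r: "r \<ge> a + b + 3" using k by (simp add: r_def)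
  have r0: "r > 0" using a b r by simp
  define m W where "m = (b\<^sup>2 - a\<^sup>2) / r\<^sup>2"
    and "W = sqrt ((r\<^sup>2 - (a + b)\<^sup>2) * (r\<^sup>2 - (a - b)\<^sup>2)) / r\<^sup>2"
  note P = jacobi_parameters[OF a b r, folded m_def W_def]
  have "(W\<^sup>2 - (1 - m)\<^sup>2) * jacobi_fun k a b 1 = 0"
  proof -
    \<comment> \<open>At \<open>x = 1\<close> the potential reduces to \<open>- a\<^sup>2\<close>,
      so the product with \<open>v 1\<close> vanishes whether or not \<open>a = 0\<close>.\<close>
    have "r\<^sup>2 / 4 * (W\<^sup>2 - (1 - m)\<^sup>2) = - a\<^sup>2" using P(6)[of 1] by simp
    then show ?thesis using jacobi_fun_endpoints(1)[OF a b, of k] r0 by auto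
  qed
  moreover have "(W\<^sup>2 - (-1 - m)\<^sup>2) * jacobi_fun k a b (-1) = 0"
  proof -
    have "r\<^sup>2 / 4 * (W\<^sup>2 - (-1 - m)\<^sup>2) = - b\<^sup>2" using P(6)[of "-1"] by simp
    then show ?thesis using jacobi_fun_endpoints(2)[OF a b, of k] r0 by auto
  qed
  moreover have "(jacobi_flux k a b has_real_derivative
      - (r\<^sup>2 / 4 * (W\<^sup>2 - (x - m)\<^sup>2) - (1 - x\<^sup>2) / 4) * jacobi_fun k a b x / (1 - x\<^sup>2)) (at x)"
    if "x \<in> {-1<..<1}" for x
  proof -
    have "r\<^sup>2 / 4 * (W\<^sup>2 - (x - m)\<^sup>2) - (1 - x\<^sup>2) / 4
        = (r\<^sup>2 - 1) / 4 * (1 - x\<^sup>2) - (a\<^sup>2 * (1 + x) + b\<^sup>2 * (1 - x)) / 2"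
      unfolding P(6) by (simp add: field_simps)
    then show ?thesis
      using jacobi_flux_has_derivative[OF that k, of a b] by (simp only: r_def)
  qed
  ultimately show ?thesis
    unfolding m_def[symmetric] W_def[symmetric]
    by (unfold_locales)
      (use P(1-5) k a b in \<open>auto simp: jacobi_flux_endpoints
         intro: continuous_on_jacobi_fun jacobi_fun_has_derivative jacobi_fun_square_integral\<close>)
qed

lemma jacobi_right_half_bound:
  fixes a b :: real
  assumes "k \<ge> 1" "a \<ge> 0" "b \<ge> 0"
    and x: "(b\<^sup>2 - a\<^sup>2) / (2 * real k + a + b + 1)\<^sup>2 \<le> x" "x \<le> delta_pm 1 k a b"
  shows "sqrt ((x - delta_pm (-1) k a b) * (delta_pm 1 k a b - x)) * (jacobi_fun k a b x)\<^sup>2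
      \<le> sqrt 2 * (189 / 200) * jacobi_hsq k a b"
  using sonin_system.sonin_bound[OF jacobi_sonin_system[OF assms(1-3)], of x] x
  unfolding delta_pm_eq by simp

lemma jacobi_fun_minus: "(jacobi_fun k a b (- x))\<^sup>2 = (jacobi_fun k b a x)\<^sup>2"
proof -
  have "((- 1) ^ k)\<^sup>2 = (1::real)"
    by (simp add: power2_eq_square flip: power_mult_distrib)
  then show ?thesis
    by (simp add: jacobi_fun_def jacobi_weight_def jacobiP_minus power_mult_distrib mult_ac)
qed

lemma jacobi_hsq_swap: "jacobi_hsq k b a = jacobi_hsq k a b"
  by (simp add: jacobi_hsq_def add_ac mult_ac)

text \<open>Left of the midpoint, the reflection \<open>x \<mapsto> - x\<close> exchanges
  \<open>a\<close> and \<open>b\<close>; the right-half bound assumes no order between them.\<close>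

lemma jacobi_fun_bound:
  fixes a b :: real
  assumes "k \<ge> 1" "a \<ge> 0" "b \<ge> 0" and x: "x \<in> {delta_pm (-1) k a b .. delta_pm 1 k a b}"
  shows "sqrt ((x - delta_pm (-1) k a b) * (delta_pm 1 k a b - x)) * (jacobi_fun k a b x)\<^sup>2
      \<le> sqrt 2 * (189 / 200) * jacobi_hsq k a b"
proof (cases "(b\<^sup>2 - a\<^sup>2) / (2 * real k + a + b + 1)\<^sup>2 \<le> x")
  case True
  then show ?thesis using assms by (intro jacobi_right_half_bound) auto
next
  case False
  have "(a\<^sup>2 - b\<^sup>2) / (2 * real k + b + a + 1)\<^sup>2 = - ((b\<^sup>2 - a\<^sup>2) / (2 * real k + a + b + 1)\<^sup>2)"
    by (simp add: add_ac diff_divide_distrib)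
  then have "(a\<^sup>2 - b\<^sup>2) / (2 * real k + b + a + 1)\<^sup>2 \<le> - x"
    using False by simp
  moreover have d: "delta_pm 1 k b a = - delta_pm (-1) k a b" "delta_pm (-1) k b a = - delta_pm 1 k a b"
    using delta_pm_swap[of 1 k b a] delta_pm_swap[of "-1" k b a] by simp_all
  ultimately have "sqrt ((- x - delta_pm (-1) k b a) * (delta_pm 1 k b a - - x)) * (jacobi_fun k b a (- x))\<^sup>2
      \<le> sqrt 2 * (189 / 200) * jacobi_hsq k b a"
    using assms by (intro jacobi_right_half_bound) auto
  then show ?thesis
    by (simp add: d jacobi_fun_minus jacobi_hsq_swap[of k b a] mult.commute)
qed

lemma delta_pm_bounds:
  fixes a b :: real
  assumes "k \<ge> 1" "a \<ge> 0" "b \<ge> 0"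
  shows "-1 \<le> delta_pm (-1) k a b" "delta_pm 1 k a b \<le> 1"
  using sonin_system.m_bounds(3,4)[OF jacobi_sonin_system[OF assms]] unfolding delta_pm_eq by auto

theorem theorem1:
  fixes k :: nat and a b :: real
  assumes "k \<ge> 1" and "a \<ge> b" and "b \<ge> 0"
  shows "\<forall>x\<in>{delta_pm (-1) k a b .. delta_pm 1 k a b}. \<bar>Zk k a b x\<bar> < 5 powr (-1/4) * sqrt 3"
proof
  fix x assume x: "x \<in> {delta_pm (-1) k a b .. delta_pm 1 k a b}"
  have a: "a \<ge> 0" using assms by simp
  let ?D = "(x - delta_pm (-1) k a b) * (delta_pm 1 k a b - x)"
  have D: "?D \<ge> 0" using x by simp
  have x1: "x \<in> {-1..1}" using x delta_pm_bounds[OF assms(1) a assms(3)] by auto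
  have h: "jacobi_hsq k a b > 0" using a assms(3) by (rule jacobi_hsq_pos)
  have "(Zk k a b x)\<^sup>2 = sqrt ?D * (jacobi_fun k a b x)\<^sup>2 / jacobi_hsq k a b"
    using D x1 h
    by (simp add: Zk_def jacobiP_on_def power_mult_distrib power_divide jacobi_fun_square jacobi_weight_def)
  also have "\<dots> \<le> sqrt 2 * (189 / 200)"
    using jacobi_fun_bound[OF assms(1) a assms(3) x] h by (simp add: divide_le_eq)
  also have "\<dots> < 3 / sqrt 5"
  proof -
    \<comment> \<open>The squares are about 1.786 and exactly 9/5.\<close>
    have "(sqrt 2 * (189 / 200))\<^sup>2 < (3 / sqrt 5)\<^sup>2"
      by (simp add: power_mult_distrib power_divide)
    then show ?thesis by (rule power2_less_imp_less) simp
  qed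
  also have "\<dots> = (5 powr (-1/4) * sqrt 3)\<^sup>2"
  proof -
    have "(5 powr (-1/4))\<^sup>2 = 5 powr (- (1 / 2) :: real)"
      by (simp add: power2_eq_square flip: powr_add)
    also have "\<dots> = 1 / sqrt 5"
      by (simp add: powr_minus_divide powr_half_sqrt)
    finally show ?thesis by (simp add: power_mult_distrib)
  qed
  finally have "\<bar>Zk k a b x\<bar>\<^sup>2 < (5 powr (-1/4) * sqrt 3)\<^sup>2" by simp
  then show "\<bar>Zk k a b x\<bar> < 5 powr (-1/4) * sqrt 3"
    by (rule power2_less_imp_less) simp
qed

end
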